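(* Let $(X,Q)$ be a principally polarized tropical abelian surface, $X=N_\mathbb{R}/M'$, and assume $(X,Q)$ is irreducible (i.e. not of product type). Let $\lambda:M'\to M$ be the isomorphism corresponding to $Q$, let $\{b_0,b_1,b_2,b_3\}\subseteq M$ be a complete system of representatives of $M/2\lambda(M')$, and let $\vartheta_{b_0},\dots,\vartheta_{b_3}$ be the tropical theta functions of second order defined below. Then the map $\psi:Y=X/\langle -1\rangle\to\mathbb{TP}^3$, $[x]\mapsto(\vartheta_{b_0}(x):\vartheta_{b_1}(x):\vartheta_{b_2}(x):\vartheta_{b_3}(x))$, is well defined and is a faithful embedding: it is injective, its image lies in the principal torus $\mathbb{R}^4/\mathbb{R}(1,1,1,1)\cong\mathbb{R}^3$, and the composite $N_\mathbb{R}\to X\to Y\xrightarrow{\psi}\mathbb{R}^3$ is unimodular.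
   Context: $M$ is a free $\mathbb{Z}$-module of rank $2$, $N=\mathrm{Hom}(M,\mathbb{Z})\subseteq N_\mathbb{R}=\mathrm{Hom}(M,\mathbb{R})$, $\langle\cdot,\cdot\rangle:M\times N_\mathbb{R}\to\mathbb{R}$ the pairing, $M'\subseteq N_\mathbb{R}$ a full lattice, and $X=N_\mathbb{R}/M'$ is a real torus with integral structure $N$. A polarization is a positive-definite symmetric bilinear form $Q$ on $N_\mathbb{R}$ with $Q(M'\times N)\subseteq\mathbb{Z}$; it corresponds to $\lambda:M'\to M$, $\lambda(u')=Q(u',\cdot)|_N$; $Q$ is principal if $\lambda$ is an isomorphism. An isomorphism of polarized tropical abelian varieties $(N_{1\mathbb{R}}/M_1',Q_1)\to(N_{2\mathbb{R}}/M_2',Q_2)$ is induced by a $\mathbb{Z}$-isomorphism $h:N_1\to N_2$ with $h_\mathbb{R}(M_1')=M_2'$ and $Q_2(h_\mathbb{R}x,h_\mathbb{R}y)=Q_1(x,y)$. The product of $(N_{i\mathbb{R}}/M_i',Q_i)$, $i=1,2$, is $((N_1\times N_2)_\mathbb{R}/(M_1'\times M_2'),Q_1\oplus Q_2)$. $(X,Q)$ is of product type if it is isomorphic to a product of two polarized tropical elliptic curves (one-dimensional polarized tropical abelian varieties), and irreducible otherwise. For $b\in M$, the tropical theta function of second order is $\vartheta_b(x)=\min_{u'\in M'}\big(2Q(x,u'+(2\lambda)_\mathbb{R}^{-1}(b))+Q(u'+(2\lambda)_\mathbb{R}^{-1}(b),u'+(2\lambda)_\mathbb{R}^{-1}(b))\big)$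 for $x\in N_\mathbb{R}$. $\mathbb{TP}^3=(\mathbb{T}^4\setminus\{(\infty,\dots,\infty)\})/\mathbb{R}(1,1,1,1)$ with $\mathbb{T}=\mathbb{R}\cup\{\infty\}$; the principal torus $\mathbb{R}^4/\mathbb{R}(1,1,1,1)$ is identified with $\mathbb{R}^3$ by $(x_0:\dots:x_3)\mapsto(x_1-x_0,x_2-x_0,x_3-x_0)$ with integral structure $\mathbb{Z}^3$. Unimodularity: a map $f:U\to\mathbb{R}^m$ on an open $U\subseteq N_\mathbb{R}$ is unimodular if every point of $U$ has an open neighborhood $U'$ and a finite polyhedral complex $\mathcal{C}$ of polyhedra rational with respect to $N$ with $U'$ open in $|\mathcal{C}|$, such that for each $\sigma\in\mathcal{C}$, $f|_{\sigma\cap U'}$ locally coincides with an affine map $x\mapsto A(x)+b$ where $A$ is linear with $A(N)\subseteq\mathbb{Z}^m$ and $A|_N:N\to\mathbb{Z}^m$ injective with torsion-free cokernel. *)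

theory Defs
  imports "HOL-Analysis.Analysis"
begin

text \<open>Conventions. N = Z^2 inside N_R = real^2. M = Hom(N,Z) is identified with Z^2
  inside real^2 via the standard dot product, so the pairing <m,x> is m \<bullet> x.
  Linear maps/bilinear forms are given by matrices.\<close>

definition int_vec :: "real^'n \<Rightarrow> bool" where
  "int_vec v \<longleftrightarrow> (\<forall>i. v $ i \<in> \<int>)"

text \<open>The integral lattice Z^n inside real^n (the lattice N, resp. M, resp. Z^m).\<close>
definition Zpts :: "(real^'n) set" where
  "Zpts = {v. int_vec v}"

text \<open>A full lattice in real^2: the Z-span of an R-basis.\<close>
definition full_lattice :: "(real^2) set \<Rightarrow> bool" where
  "full_lattice L \<longleftrightarrow> (\<exists>v1 v2. v1 \<noteq> v2 \<and> independent {v1, v2} \<and>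
      L = {of_int a *\<^sub>R v1 + of_int c *\<^sub>R v2 | a c. True})"

text \<open>The bilinear form with matrix Q.\<close>
definition bform :: "real^2^2 \<Rightarrow> real^2 \<Rightarrow> real^2 \<Rightarrow> real" where
  "bform Q x y = x \<bullet> (Q *v y)"

text \<open>Polarization on N_R / L: positive-definite symmetric form with Q(L x N) in Z.\<close>
definition polarization :: "(real^2) set \<Rightarrow> real^2^2 \<Rightarrow> bool" where
  "polarization L Q \<longleftrightarrow> transpose Q = Q \<and> (\<forall>x. x \<noteq> 0 \<longrightarrow> bform Q x x > 0) \<and>
     (\<forall>u\<in>L. \<forall>n\<in>Zpts. bform Q u n \<in> \<int>)"

text \<open>lambda(u') = Q(u',.)|_N, as element of M = Z^2 (via the dot product);
  its R-linear extension is x \<mapsto> Q(x,.).\<close>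
definition pol_lambda :: "real^2^2 \<Rightarrow> real^2 \<Rightarrow> real^2" where
  "pol_lambda Q u = transpose Q *v u"

definition principal :: "(real^2) set \<Rightarrow> real^2^2 \<Rightarrow> bool" where
  "principal L Q \<longleftrightarrow> bij_betw (pol_lambda Q) L Zpts"

text \<open>(2 lambda)_R^{-1}(b)\<close>
definition half_lambda_inv :: "real^2^2 \<Rightarrow> real^2 \<Rightarrow> real^2" where
  "half_lambda_inv Q b = inv (\<lambda>x. 2 *\<^sub>R pol_lambda Q x) b"

definition theta_term :: "real^2^2 \<Rightarrow> real^2 \<Rightarrow> real^2 \<Rightarrow> real^2 \<Rightarrow> real" where
  "theta_term Q b x u = (let w = u + half_lambda_inv Q b in 2 * bform Q x w + bform Q w w)"

text \<open>Tropical theta function of second order (the minimum is taken as an infimum;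
  that it is attained is part of the theorem).\<close>
definition theta :: "(real^2) set \<Rightarrow> real^2^2 \<Rightarrow> real^2 \<Rightarrow> real^2 \<Rightarrow> real" where
  "theta L Q b x = Inf (theta_term Q b x ` L)"

text \<open>Product type: isomorphic (via a Z-isomorphism h : N -> Z x Z) to the product of two
  polarized tropical elliptic curves (R / l_i Z, Q_i(x,y) = q_i x y) with l_i \<noteq> 0,
  q_i > 0, Q_i(l_i Z x Z) in Z.\<close>
definition product_type :: "(real^2) set \<Rightarrow> real^2^2 \<Rightarrow> bool" where
  "product_type L Q \<longleftrightarrow> (\<exists>H :: real^2^2. \<exists>l1 l2 q1 q2 :: real.
      inj ((*v) H) \<and> (*v) H ` Zpts = Zpts \<and>
      l1 \<noteq> 0 \<and> l2 \<noteq> 0 \<and> q1 > 0 \<and> q2 > 0 \<and> q1 * l1 \<in> \<int> \<and> q2 * l2 \<in> \<int> \<and>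
      (*v) H ` L = {v. \<exists>a c :: int. v $ 1 = of_int a * l1 \<and> v $ 2 = of_int c * l2} \<and>
      (\<forall>x y. bform Q x y = q1 * (H *v x) $ 1 * (H *v y) $ 1 + q2 * (H *v x) $ 2 * (H *v y) $ 2))"

text \<open>Polyhedra rational with respect to N: finite intersections of half-spaces
  with integral normal vectors.\<close>
definition rational_polyhedron :: "(real^'n) set \<Rightarrow> bool" where
  "rational_polyhedron P \<longleftrightarrow> (\<exists>F. finite F \<and> (\<forall>(a, c) \<in> F. int_vec a) \<and>
      P = {x. \<forall>(a, c) \<in> F. a \<bullet> x \<le> c})"

definition polyhedral_complex :: "(real^'n) set set \<Rightarrow> bool" where
  "polyhedral_complex C \<longleftrightarrow> finite C \<and>
     (\<forall>\<sigma>\<in>C. rational_polyhedron \<sigma> \<and> \<sigma> \<noteq> {}) \<and>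
     (\<forall>\<sigma>\<in>C. \<forall>F. F face_of \<sigma> \<and> F \<noteq> {} \<longrightarrow> F \<in> C) \<and>
     (\<forall>\<sigma>\<in>C. \<forall>\<tau>\<in>C. (\<sigma> \<inter> \<tau>) face_of \<sigma> \<and> (\<sigma> \<inter> \<tau>) face_of \<tau>)"

text \<open>Integral linear map A (matrix) with A(N) in Z^m, A|_N injective, torsion-free cokernel.\<close>
definition unimodular_linear :: "real^'n^'m \<Rightarrow> bool" where
  "unimodular_linear A \<longleftrightarrow> (\<forall>n\<in>Zpts. int_vec (A *v n)) \<and> inj_on ((*v) A) Zpts \<and>
     (\<forall>y\<in>Zpts. \<forall>k::int. k \<noteq> 0 \<longrightarrow> of_int k *\<^sub>R y \<in> (*v) A ` Zpts \<longrightarrow> y \<in> (*v) A ` Zpts)"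

definition unimodular_on :: "(real^'n) set \<Rightarrow> (real^'n \<Rightarrow> real^'m) \<Rightarrow> bool" where
  "unimodular_on U f \<longleftrightarrow> (\<forall>p\<in>U. \<exists>U' C. open U' \<and> p \<in> U' \<and> U' \<subseteq> U \<and>
      polyhedral_complex C \<and> openin (top_of_set (\<Union>C)) U' \<and>
      (\<forall>\<sigma>\<in>C. \<forall>q\<in>\<sigma> \<inter> U'. \<exists>V. open V \<and> q \<in> V \<and>
         (\<exists>A b. unimodular_linear A \<and> (\<forall>x\<in>\<sigma> \<inter> U' \<inter> V. f x = A *v x + b))))"

end

theory Submission
  imports Defs
begin

text \<open>A basis \<open>g, h\<close> of the lattice with \<open>Q(g) + Q(h) + Q(g + h)\<close> minimal is Selling reduced:
  \<open>Q(s g + t h) = p s\<^sup>2 + q t\<^sup>2 + r (s - t)\<^sup>2\<close> with \<open>p, q, r \<ge> 0\<close>, and a vanishing coefficient would give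
  an orthogonal basis, hence a product. In the coordinates \<open>x = - (y g + z h) / 2\<close> the theta function
  of a class modulo 2 is, up to a summand common to all classes, a quarter of the squared distance from
  \<open>(y, z)\<close> to the integral points in that class. On the triangle \<open>0 \<le> z \<le> y \<le> 1\<close> the nearest points of
  three of the classes are the vertices \<open>(0, 0), (1, 0), (1, 1)\<close>, because the three squares in the form
  are minimised simultaneously. As the translates of this triangle and of its negative by integral points
  cover the plane, three theta functions always give unimodular affine coordinates. The fourth class
  contributes a nonnegative excess over the sum of the separate minima, which vanishes only on the
  boundary of the triangle; this separates the images of triangles with different vertex classes.
  Cells of unimodularity are those of a finite arrangement of the lines on which two theta terms agree.\<close>

section \<open>Nearest points of the classes modulo 2\<close>

definition sform :: "real \<Rightarrow> real \<Rightarrow> real \<Rightarrow> real \<Rightarrow> real \<Rightarrow> real" where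
  "sform p q r s t = p * s\<^sup>2 + q * t\<^sup>2 + r * (s - t)\<^sup>2"

text \<open>Only points of the same class modulo 2 compete. A relation instead of a chosen
  minimiser, because on the walls several points of a class tie and any of them serves.\<close>

definition nearest :: "real \<Rightarrow> real \<Rightarrow> real \<Rightarrow> real \<Rightarrow> real \<Rightarrow> int \<Rightarrow> int \<Rightarrow> bool" where
  "nearest p q r y z k l \<longleftrightarrow> (\<forall>i j. even (i - k) \<and> even (j - l) \<longrightarrow>
     sform p q r (of_int k - y) (of_int l - z) \<le> sform p q r (of_int i - y) (of_int j - z))"

lemma sform_uminus [simp]: "sform p q r (- s) (- t) = sform p q r s t"
  unfolding sform_def by (simp add: power2_eq_square algebra_simps)

lemma nearest_shift:
  assumes "nearest p q r y z k l"
  shows "nearest p q r (y + of_int f) (z + of_int g) (k + f) (l + g)"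
  unfolding nearest_def
proof (intro allI impI)
  fix i j :: int assume "even (i - (k + f)) \<and> even (j - (l + g))"
  then have "even ((i - f) - k) \<and> even ((j - g) - l)" by (simp add: algebra_simps)
  then have "sform p q r (of_int k - y) (of_int l - z)
      \<le> sform p q r (of_int (i - f) - y) (of_int (j - g) - z)"
    using assms unfolding nearest_def by blast
  then show "sform p q r (of_int (k + f) - (y + of_int f)) (of_int (l + g) - (z + of_int g))
      \<le> sform p q r (of_int i - (y + of_int f)) (of_int j - (z + of_int g))"
    by (simp add: algebra_simps)
qed

lemma nearest_uminus:
  assumes "nearest p q r y z k l"
  shows "nearest p q r (- y) (- z) (- k) (- l)"
  unfolding nearest_def
proof (intro allI impI)
  fix i j :: int assume "even (i - - k) \<and> even (j - - l)"
  then have "even (- i - k) \<and> even (- j - l)" by simp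
  then have "sform p q r (of_int k - y) (of_int l - z)
      \<le> sform p q r (of_int (- i) - y) (of_int (- j) - z)"
    using assms unfolding nearest_def by blast
  then have "sform p q r (- (of_int k - y)) (- (of_int l - z))
      \<le> sform p q r (- (of_int (- i) - y)) (- (of_int (- j) - z))"
    unfolding sform_uminus .
  then show "sform p q r (of_int (- k) - - y) (of_int (- l) - - z)
      \<le> sform p q r (of_int i - - y) (of_int j - - z)"
    by (simp add: algebra_simps)
qed

text \<open>The maps \<open>v -> s v + (f, g)\<close> with \<open>s = 1\<close> or
  \<open>s = - 1\<close> are isometries of the form and permute the classes modulo 2. They carry
  statements about one triangle to the whole plane.\<close>

lemma nearest_affine:
  assumes "nearest p q r y z k l" "s = 1 \<or> s = - 1"
  shows "nearest p q r (of_int s * y + of_int f) (of_int s * z + of_int g) (s * k + f) (s * l + g)"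
  using assms(2) nearest_shift[OF assms(1), of f g]
    nearest_shift[OF nearest_uminus[OF assms(1)], of f g] by auto

lemma sform_affine:
  assumes "s = 1 \<or> s = (- 1 :: int)"
  shows "sform p q r (of_int (s * k + f) - (of_int s * y + of_int f))
      (of_int (s * l + g) - (of_int s * z + of_int g)) = sform p q r (of_int k - y) (of_int l - z)"
proof -
  have "of_int (s * k + f) - (of_int s * y + of_int f) = of_int s * (of_int k - y)"
    "of_int (s * l + g) - (of_int s * z + of_int g) = of_int s * (of_int l - z)"
    by (simp_all add: algebra_simps)
  moreover have "sform p q r (- (of_int k - y)) (- (of_int l - z)) = sform p q r (of_int k - y) (of_int l - z)"
    by (rule sform_uminus)
  ultimately show ?thesis using assms by (elim disjE) (simp_all only: of_int_1 of_int_minus mult_1 mult_minus1)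
qed

text \<open>For a point of [0, 1] the best even integer is 0 and the runner-up is 2. The price of
  the runner-up, \<open>4 * (1 - z)\<close>, reappears as an excess in
  \<open>nearest_01_lower\<close>.\<close>

lemma square_dist_even:
  fixes z :: real assumes "even k" "0 \<le> z" "z \<le> 1"
  shows "z\<^sup>2 \<le> (of_int k - z)\<^sup>2" and "k \<noteq> 0 \<Longrightarrow> (2 - z)\<^sup>2 \<le> (of_int k - z)\<^sup>2"
proof -
  have "k = 0 \<or> k \<ge> 2 \<or> k \<le> - 2" using assms(1) by presburger
  then have c: "k = 0 \<or> real_of_int k \<ge> 2 \<or> real_of_int k \<le> - 2" by linarith
  show "z\<^sup>2 \<le> (of_int k - z)\<^sup>2"
    using c assms by (intro abs_le_square_iff[THEN iffD1]) auto
  show "k \<noteq> 0 \<Longrightarrow> (2 - z)\<^sup>2 \<le> (of_int k - z)\<^sup>2"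
    using c assms by (intro abs_le_square_iff[THEN iffD1]) auto
qed

lemma square_dist_odd:
  fixes z :: real assumes "odd k" "0 \<le> z" "z \<le> 1"
  shows "(1 - z)\<^sup>2 \<le> (of_int k - z)\<^sup>2" and "k \<noteq> 1 \<Longrightarrow> (1 + z)\<^sup>2 \<le> (of_int k - z)\<^sup>2"
proof -
  have "k = 1 \<or> k \<ge> 3 \<or> k \<le> - 1" using assms(1) by presburger
  then have c: "k = 1 \<or> real_of_int k \<ge> 3 \<or> real_of_int k \<le> - 1" by linarith
  show "(1 - z)\<^sup>2 \<le> (of_int k - z)\<^sup>2"
    using c assms by (intro abs_le_square_iff[THEN iffD1]) auto
  show "k \<noteq> 1 \<Longrightarrow> (1 + z)\<^sup>2 \<le> (of_int k - z)\<^sup>2"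
    using c assms by (intro abs_le_square_iff[THEN iffD1]) auto
qed

lemma sform_mono:
  assumes "0 < p" "0 < q" "0 < r" "s\<^sup>2 \<le> s'\<^sup>2" "t\<^sup>2 \<le> t'\<^sup>2" "(s - t)\<^sup>2 \<le> (s' - t')\<^sup>2"
  shows "sform p q r s t \<le> sform p q r s' t'"
  unfolding sform_def using assms by (intro add_mono mult_left_mono) auto

context
  fixes p q r y z :: real
  assumes pos: "0 < p" "0 < q" "0 < r" and tri: "0 \<le> z" "z \<le> y" "y \<le> 1"
begin

text \<open>On the triangle \<open>y\<close>, \<open>z\<close> and \<open>y - z\<close> all lie in
  [0, 1]. For each of them 0 is a nearest even integer, and 0 - 0 = 0, so one integral point
  minimises all three squares at once. The same works for \<open>nearest_10\<close> with 1, 0, 1 and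
  for \<open>nearest_11\<close> with 1, 1, 0.\<close>

lemma nearest_00: "nearest p q r y z 0 0"
  unfolding nearest_def
proof (intro allI impI)
  fix i j :: int assume "even (i - 0) \<and> even (j - 0)"
  then have "even i" "even j" "even (i - j)" by auto
  then show "sform p q r (of_int 0 - y) (of_int 0 - z) \<le> sform p q r (of_int i - y) (of_int j - z)"
    using square_dist_even(1)[of i y] square_dist_even(1)[of j z] square_dist_even(1)[of "i - j" "y - z"] tri pos
    by (intro sform_mono) (auto simp: algebra_simps power2_commute)
qed

lemma nearest_10: "nearest p q r y z 1 0"
  unfolding nearest_def
proof (intro allI impI)
  fix i j :: int assume "even (i - 1) \<and> even (j - 0)"
  then have "odd i" "even j" "odd (i - j)" by auto
  then show "sform p q r (of_int 1 - y) (of_int 0 - z) \<le> sform p q r (of_int i - y) (of_int j - z)"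
    using square_dist_odd(1)[of i y] square_dist_even(1)[of j z] square_dist_odd(1)[of "i - j" "y - z"] tri pos
    by (intro sform_mono) (auto simp: algebra_simps power2_commute)
qed

lemma nearest_11: "nearest p q r y z 1 1"
  unfolding nearest_def
proof (intro allI impI)
  fix i j :: int assume "even (i - 1) \<and> even (j - 1)"
  then have "odd i" "odd j" "even (i - j)" by auto
  then show "sform p q r (of_int 1 - y) (of_int 1 - z) \<le> sform p q r (of_int i - y) (of_int j - z)"
    using square_dist_odd(1)[of i y] square_dist_odd(1)[of j z] square_dist_even(1)[of "i - j" "y - z"] tri pos
    by (intro sform_mono) (auto simp: algebra_simps power2_commute)
qed

text \<open>The separate minima of the three squares sit at \<open>i = 0\<close>,
  \<open>j = 1\<close> and \<open>i - j = 1\<close>, which is inconsistent. At least one square must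
  use its runner-up, at a cost of \<open>4 * p * (1 - y)\<close>, \<open>4 * q * z\<close> or
  \<open>4 * r * (y - z)\<close>.\<close>

lemma nearest_01_lower:
  assumes "even i" "odd j"
  shows "p * y\<^sup>2 + q * (1 - z)\<^sup>2 + r * (1 - (y - z))\<^sup>2 + 4 * min (p * (1 - y)) (min (q * z) (r * (y - z)))
    \<le> sform p q r (of_int i - y) (of_int j - z)" (is "?a + ?b + ?c + 4 * ?m \<le> _")
proof -
  have o: "odd (i - j)" using assms by auto
  have e: "of_int (i - j) - (y - z) = (of_int i - y) - (of_int j - z)" by simp
  have a: "?a \<le> p * (of_int i - y)\<^sup>2" "i \<noteq> 0 \<Longrightarrow> p * (2 - y)\<^sup>2 \<le> p * (of_int i - y)\<^sup>2"
    using square_dist_even[of i y] assms tri pos by (auto intro!: mult_left_mono)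
  have b: "?b \<le> q * (of_int j - z)\<^sup>2" "j \<noteq> 1 \<Longrightarrow> q * (1 + z)\<^sup>2 \<le> q * (of_int j - z)\<^sup>2"
    using square_dist_odd[of j z] assms tri pos by (auto intro!: mult_left_mono)
  have c: "?c \<le> r * ((of_int i - y) - (of_int j - z))\<^sup>2"
     "i - j \<noteq> 1 \<Longrightarrow> r * (1 + (y - z))\<^sup>2 \<le> r * ((of_int i - y) - (of_int j - z))\<^sup>2"
    using square_dist_odd[OF o, of "y - z"] tri pos unfolding e by (auto intro!: mult_left_mono)
  have m: "?m \<le> p * (1 - y)" "?m \<le> q * z" "?m \<le> r * (y - z)" by auto
  have s: "p * (2 - y)\<^sup>2 = ?a + 4 * (p * (1 - y))" "q * (1 + z)\<^sup>2 = ?b + 4 * (q * z)"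
     "r * (1 + (y - z))\<^sup>2 = ?c + 4 * (r * (y - z))"
    by (simp_all add: power2_eq_square algebra_simps)
  have "i \<noteq> 0 \<or> j \<noteq> 1 \<or> i - j \<noteq> 1" by auto
  then show ?thesis using a b c m unfolding s sform_def by linarith
qed

lemma nearest_01:
  obtains k l where "nearest p q r y z k l" "even k" "odd l" "k \<in> {0, 2}" "l \<in> {1, - 1}"
    "sform p q r (of_int k - y) (of_int l - z) \<ge> p * y\<^sup>2 + q * (1 - z)\<^sup>2 + r * (1 - (y - z))\<^sup>2"
proof -
  let ?m = "min (p * (1 - y)) (min (q * z) (r * (y - z)))"
  let ?B = "p * y\<^sup>2 + q * (1 - z)\<^sup>2 + r * (1 - (y - z))\<^sup>2"
  have "\<exists>k l. k \<in> {0, 2} \<and> l \<in> {1, - 1} \<and> sform p q r (of_int k - y) (of_int l - z) = ?B + 4 * ?m"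
  proof -
    \<comment> \<open>Each alternative can be realised alone: (2, 1), (0, -1) and (0, 1) violate
      exactly one of the three equations, so the cheapest one attains the lower bound.\<close>
    consider "?m = p * (1 - y)" | "?m = q * z" | "?m = r * (y - z)" by linarith
    then show ?thesis
    proof cases
      case 1 show ?thesis unfolding 1
        by (rule exI[of _ 2], rule exI[of _ 1]) (simp add: sform_def power2_eq_square algebra_simps)
    next
      case 2 show ?thesis unfolding 2
        by (rule exI[of _ 0], rule exI[of _ "-1"]) (simp add: sform_def power2_eq_square algebra_simps)
    next
      case 3 show ?thesis unfolding 3
        by (rule exI[of _ 0], rule exI[of _ 1]) (simp add: sform_def power2_eq_square algebra_simps)
    qed
  qed
  then obtain k l where kl: "k \<in> {0, 2}" "l \<in> {1, - 1}"
    "sform p q r (of_int k - y) (of_int l - z) = ?B + 4 * ?m" by blast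
  have eo: "even k" "odd l" using kl by auto
  have "nearest p q r y z k l"
    unfolding nearest_def kl(3) using nearest_01_lower eo by auto
  moreover have "?m \<ge> 0" using pos tri by simp
  ultimately show ?thesis using that[of k l] kl eo by linarith
qed

end

section \<open>Reduction to one triangle by integral affine maps\<close>

lemma triangle_cover:
  fixes y z :: real
  obtains s f g :: int and y' z' where "s = 1 \<or> s = - 1" "0 \<le> z'" "z' \<le> y'" "y' \<le> 1"
    "y = of_int s * y' + of_int f" "z = of_int s * z' + of_int g"
proof (cases "frac z \<le> frac y")
  case True
  then show ?thesis
    using that[of 1 "frac z" "frac y" "\<lfloor>y\<rfloor>" "\<lfloor>z\<rfloor>"] frac_lt_1[of y] by (simp add: frac_def)
next
  \<comment> \<open>The other half of the unit square is the image of the triangle under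
    \<open>v -> (1, 1) - v\<close>.\<close>
  case False
  then show ?thesis
    using that[of "-1" "1 - frac z" "1 - frac y" "\<lfloor>y\<rfloor> + 1" "\<lfloor>z\<rfloor> + 1"] frac_lt_1[of z] frac_ge_0[of y]
    by (simp add: frac_def)
qed

text \<open>The bound 2 covers the vertices and the candidates (2, 1), (0, -1), (0, 1) as seen from
  the triangle. It later confines the relevant theta terms over a ball to a finite set.\<close>

lemma nearest_exists_bounded:
  assumes "0 < p" "0 < q" "0 < r"
  obtains k l where "nearest p q r y z k l" "even (k - a)" "even (l - b)"
    "\<bar>of_int k - y\<bar> \<le> 2" "\<bar>of_int l - z\<bar> \<le> 2"
proof -
  obtain s f g :: int and y' z' where s: "s = 1 \<or> s = - 1" and t: "0 \<le> z'" "z' \<le> y'" "y' \<le> 1"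
    and yz: "y = of_int s * y' + of_int f" "z = of_int s * z' + of_int g"
    by (rule triangle_cover)
  \<comment> \<open>The class of \<open>(a, b)\<close> pulls back to that of
    \<open>(a - f, b - g)\<close>; the sign \<open>s\<close> is invisible modulo 2.\<close>
  have "\<exists>k l. nearest p q r y' z' k l \<and> even (k - (a - f)) \<and> even (l - (b - g)) \<and>
      \<bar>of_int k - y'\<bar> \<le> 2 \<and> \<bar>of_int l - z'\<bar> \<le> 2"
  proof (cases "even (a - f)"; cases "even (b - g)")
    assume "even (a - f)" "even (b - g)"
    then show ?thesis using nearest_00[OF assms t] t by (intro exI[of _ 0]) auto
  next
    assume "odd (a - f)" "even (b - g)"
    then show ?thesis using nearest_10[OF assms t] t by (intro exI[of _ 1] exI[of _ 0]) auto
  next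
    assume "odd (a - f)" "odd (b - g)"
    then show ?thesis using nearest_11[OF assms t] t by (intro exI[of _ 1]) auto
  next
    assume ab: "even (a - f)" "odd (b - g)"
    obtain k l where "nearest p q r y' z' k l" "even k" "odd l" "k \<in> {0, 2}" "l \<in> {1, - 1}"
      by (rule nearest_01[OF assms t])
    then show ?thesis using t ab by (intro exI[of _ k] exI[of _ l]) auto
  qed
  then obtain k l where kl: "nearest p q r y' z' k l" "even (k - (a - f))" "even (l - (b - g))"
      "\<bar>of_int k - y'\<bar> \<le> 2" "\<bar>of_int l - z'\<bar> \<le> 2" by blast
  have "nearest p q r y z (s * k + f) (s * l + g)"
    unfolding yz using nearest_affine[OF kl(1) s] .
  moreover have "even (s * k + f - a)" "even (s * l + g - b)" using s kl by auto
  moreover have "\<bar>of_int (s * k + f) - y\<bar> \<le> 2" "\<bar>of_int (s * l + g) - z\<bar> \<le> 2"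
    using s kl(4,5) unfolding yz by (auto simp: abs_if split: if_splits)
  ultimately show ?thesis using that by blast
qed

text \<open>The integers \<open>h\<close> and \<open>g\<close> record how the classes of the two
  triangles are matched. If both are even, vertex minima correspond to vertex minima and determine
  the point by linear equations. Otherwise the fourth class of each triangle is compared with a
  vertex of the other, and the excess inequalities leave only points that are reflections of each
  other in half an integral point.\<close>

lemma triangle_injective:
  fixes y z y' z' :: real and h g :: int
  assumes pos: "0 < p" "0 < q" "0 < r"
    and t: "0 \<le> z" "z \<le> y" "y \<le> 1" and t': "0 \<le> z'" "z' \<le> y'" "y' \<le> 1"
    and eq: "\<And>k l k' l'. \<lbrakk>nearest p q r y z k l; nearest p q r y' z' k' l'; even (k + k' + h); even (l + l' + g)\<rbrakk>
       \<Longrightarrow> sform p q r (of_int k - y) (of_int l - z) = sform p q r (of_int k' - y') (of_int l' - z') + T"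
  shows "(even h \<and> even g \<and> y = y' \<and> z = z') \<or>
    (\<exists>m n :: int. y + y' = of_int m \<and> z + z' = of_int n \<and> even (m + h) \<and> even (n + g))"
proof -
  define F where "F k l = sform p q r (of_int k - y) (of_int l - z)" for k l :: int
  define F' where "F' k l = sform p q r (of_int k - y') (of_int l - z')" for k l :: int
  \<comment> \<open>\<open>P\<close>, \<open>S\<close> and \<open>R\<close> are the increments of
    the squares with weights \<open>p\<close>, \<open>q\<close> and \<open>r\<close> when the
    integer in them passes from 0 to 1. The constant \<open>T\<close> drops out of such
    differences.\<close>
  define P where "P = p * (1 - 2 * y)"
  define R where "R = r * (1 - 2 * (y - z))"
  define S where "S = q * (1 - 2 * z)"
  define P' where "P' = p * (1 - 2 * y')"
  define R' where "R' = r * (1 - 2 * (y' - z'))"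
  define S' where "S' = q * (1 - 2 * z')"
  note eq = eq[folded F_def F'_def]
  note n = nearest_00[OF pos t] nearest_10[OF pos t] nearest_11[OF pos t]
  note n' = nearest_00[OF pos t'] nearest_10[OF pos t'] nearest_11[OF pos t']
  obtain k l where kl: "nearest p q r y z k l" "even k" "odd l" "F k l \<ge> F 0 0 + S + R"
    by (rule nearest_01[OF pos t]) (auto simp: F_def R_def S_def sform_def power2_eq_square algebra_simps)
  obtain k' l' where kl': "nearest p q r y' z' k' l'" "even k'" "odd l'" "F' k' l' \<ge> F' 0 0 + S' + R'"
    by (rule nearest_01[OF pos t']) (auto simp: F'_def R'_def S'_def sform_def power2_eq_square algebra_simps)
  have v: "F 1 0 = F 0 0 + P + R" "F 1 1 = F 0 0 + P + S"
    "F' 1 0 = F' 0 0 + P' + R'" "F' 1 1 = F' 0 0 + P' + S'"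
    unfolding F_def F'_def P_def R_def S_def P'_def R'_def S'_def sform_def
    by (simp_all add: power2_eq_square algebra_simps)
  have P: "P + P' = 2 * p * (1 - (y + y'))" unfolding P_def P'_def by (simp add: algebra_simps)
  have R: "R + R' = 2 * r * (1 - ((y - z) + (y' - z')))" unfolding R_def R'_def by (simp add: algebra_simps)
  have S: "S + S' = 2 * q * (1 - (z + z'))" unfolding S_def S'_def by (simp add: algebra_simps)
  show ?thesis
  proof (cases "even h"; cases "even g")
    assume "even h" "even g"
    then have "F 0 0 = F' 0 0 + T" "F 1 0 = F' 1 0 + T" "F 1 1 = F' 1 1 + T"
      using eq[OF n(1) n'(1)] eq[OF n(2) n'(2)] eq[OF n(3) n'(3)] by auto
    then have "P + R = P' + R'" "P + S = P' + S'" using v by auto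
    then have a: "p * (y - y') + r * ((y - y') - (z - z')) = 0" "p * (y - y') + q * (z - z') = 0"
      unfolding P_def R_def S_def P'_def R'_def S'_def by (auto simp: algebra_simps)
    define d e where "d = y - y'" and "e = z - z'"
    have a: "p * d + r * (d - e) = 0" "p * d + q * e = 0" using a unfolding d_def e_def by auto
    have "p * q * d + r * (q * d) - r * (q * e) = q * (p * d + r * (d - e))" by (simp add: algebra_simps)
    also have "\<dots> = 0" using a by simp
    \<comment> \<open>The coefficient \<open>p * q + r * q + r * p\<close> is the determinant of the
      Gram matrix of \<open>sform p q r\<close>.\<close>
    finally have "(p * q + r * q + r * p) * d = r * (p * d + q * e)" by (simp add: algebra_simps)
    moreover have "p * q + r * q + r * p > 0" using pos by (intro add_pos_pos) auto
    ultimately have "d = 0" using a by simp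
    then have "e = 0" using a pos by auto
    then show ?thesis using \<open>even h\<close> \<open>even g\<close> \<open>d = 0\<close> unfolding d_def e_def by auto
  next
    assume h: "odd h" "even g"
    then have "F 0 0 = F' 1 0 + T" "F 1 0 = F' 0 0 + T" "F 1 1 = F' k' l' + T" "F k l = F' 1 1 + T"
      using eq[OF n(1) n'(2)] eq[OF n(2) n'(1)] eq[OF n(3) kl'(1)] eq[OF kl(1) n'(3)] kl kl' by auto
    \<comment> \<open>The first two equations give \<open>P + R = - (P' + R')\<close>. Adding the
      lower bounds for the fourth class at both points cancels \<open>S + S'\<close> and leaves
      \<open>R + R' \<le> 0\<close>.\<close>
    then have "P + P' \<ge> 0" "R + R' \<le> 0" using v kl(4) kl'(4) by linarith+
    then have "y + y' \<le> 1" "(y - z) + (y' - z') \<ge> 1"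
      unfolding P R using pos by (auto simp: zero_le_mult_iff mult_le_0_iff)
    then have "y + y' = of_int 1" "z + z' = of_int 0" using t t' by auto
    then show ?thesis using h by (metis add.left_neutral even_add odd_one)
  next
    assume h: "even h" "odd g"
    then have "F 1 0 = F' 1 1 + T" "F 1 1 = F' 1 0 + T" "F 0 0 = F' k' l' + T" "F k l = F' 0 0 + T"
      using eq[OF n(2) n'(3)] eq[OF n(3) n'(2)] eq[OF n(1) kl'(1)] eq[OF kl(1) n'(1)] kl kl' by auto
    then have "S + S' \<le> 0" "R + R' \<le> 0" using v kl(4) kl'(4) by linarith+
    then have "z + z' \<ge> 1" "(y - z) + (y' - z') \<ge> 1"
      unfolding S R using pos by (auto simp: mult_le_0_iff)
    then have "y + y' = of_int 2" "z + z' = of_int 1" using t t' by auto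
    then show ?thesis using h by (metis even_add odd_one even_numeral)
  next
    assume h: "odd h" "odd g"
    then have "F 0 0 = F' 1 1 + T" "F 1 1 = F' 0 0 + T" "F 1 0 = F' k' l' + T" "F k l = F' 1 0 + T"
      using eq[OF n(1) n'(3)] eq[OF n(3) n'(1)] eq[OF n(2) kl'(1)] eq[OF kl(1) n'(2)] kl kl' by auto
    then have "P + P' \<ge> 0" "S + S' \<le> 0" using v kl(4) kl'(4) by linarith+
    then have "y + y' \<le> 1" "z + z' \<ge> 1"
      unfolding P S using pos by (auto simp: zero_le_mult_iff mult_le_0_iff)
    then have "y + y' = of_int 1" "z + z' = of_int 1" using t t' by auto
    then show ?thesis using h by (metis even_add odd_one)
  qed
qed

lemma class_minima_injective:
  fixes y z y' z' :: real
  assumes pos: "0 < p" "0 < q" "0 < r"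
    and eq: "\<And>k l k' l'. \<lbrakk>nearest p q r y z k l; nearest p q r y' z' k' l'; even (k - k'); even (l - l')\<rbrakk>
       \<Longrightarrow> sform p q r (of_int k - y) (of_int l - z) = sform p q r (of_int k' - y') (of_int l' - z') + T"
  shows "(\<exists>m n :: int. y - y' = 2 * of_int m \<and> z - z' = 2 * of_int n) \<or>
    (\<exists>m n :: int. y + y' = 2 * of_int m \<and> z + z' = 2 * of_int n)"
proof -
  obtain s f g :: int and u v where s: "s = 1 \<or> s = - 1" and t: "0 \<le> v" "v \<le> u" "u \<le> 1"
    and yz: "y = of_int s * u + of_int f" "z = of_int s * v + of_int g"
    by (rule triangle_cover)
  obtain s' f' g' :: int and u' v' where s': "s' = 1 \<or> s' = - 1" and t': "0 \<le> v'" "v' \<le> u'" "u' \<le> 1"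
    and yz': "y' = of_int s' * u' + of_int f'" "z' = of_int s' * v' + of_int g'"
    by (rule triangle_cover)
  \<comment> \<open>Modulo 2 the signs \<open>s\<close> and \<open>s'\<close> disappear, so equal
    classes in the original coordinates mean that \<open>k + k' + (f + f')\<close> is even, and
    likewise in the second coordinate.\<close>
  have *: "(even (f + f') \<and> even (g + g') \<and> u = u' \<and> v = v') \<or>
    (\<exists>m n :: int. u + u' = of_int m \<and> v + v' = of_int n \<and> even (m + (f + f')) \<and> even (n + (g + g')))"
  proof (rule triangle_injective[OF pos t t'])
    fix k l k' l'
    assume a: "nearest p q r u v k l" "nearest p q r u' v' k' l'"
      "even (k + k' + (f + f'))" "even (l + l' + (g + g'))"
    have "even ((s * k + f) - (s' * k' + f'))" "even ((s * l + g) - (s' * l' + g'))"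
      using a(3,4) s s' by auto
    then show "sform p q r (of_int k - u) (of_int l - v) = sform p q r (of_int k' - u') (of_int l' - v') + T"
      using eq[of "s * k + f" "s * l + g" "s' * k' + f'" "s' * l' + g'"]
        nearest_affine[OF a(1) s, of f g] nearest_affine[OF a(2) s', of f' g']
      unfolding yz yz' sform_affine[OF s] sform_affine[OF s'] by blast
  qed
  have half: "\<exists>m :: int. x = 2 * of_int m" if "x = of_int n" "even n" for x :: real and n
    using that by (auto elim!: evenE)
  have dvd: "even (f - f') = even (f + f')" "even (g - g') = even (g + g')" by auto
  from * show ?thesis
  proof
    assume a: "even (f + f') \<and> even (g + g') \<and> u = u' \<and> v = v'"
    show ?thesis
    proof (cases "s = s'")
      case True
      then have "y - y' = of_int (f - f')" "z - z' = of_int (g - g')" using a yz yz' by auto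
      then show ?thesis using half a dvd by metis
    next
      case False
      then have "s' = - s" using s s' by auto
      then have "y + y' = of_int (f + f')" "z + z' = of_int (g + g')" using a yz yz' by auto
      then show ?thesis using half a by metis
    qed
  next
    assume "\<exists>m n :: int. u + u' = of_int m \<and> v + v' = of_int n \<and> even (m + (f + f')) \<and> even (n + (g + g'))"
    then obtain m n :: int where mn: "u + u' = of_int m" "v + v' = of_int n"
      "even (m + (f + f'))" "even (n + (g + g'))" by blast
    have m: "u' = of_int m - u" "v' = of_int n - v" using mn by auto
    show ?thesis
    proof (cases "s = s'")
      case True
      then have "y + y' = of_int (s * m + (f + f'))" "z + z' = of_int (s * n + (g + g'))"
        unfolding yz yz' m by (auto simp: algebra_simps)
      moreover have "even (s * m + (f + f'))" "even (s * n + (g + g'))" using mn s by auto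
      ultimately show ?thesis using half by metis
    next
      case False
      then have "s' = - s" using s s' by auto
      then have "y - y' = of_int (s * m + (f - f'))" "z - z' = of_int (s * n + (g - g'))"
        unfolding yz yz' m by (auto simp: algebra_simps)
      moreover have "even (s * m + (f - f'))" "even (s * n + (g - g'))" using mn s by auto
      ultimately show ?thesis using half by metis
    qed
  qed
qed

section \<open>Hyperplane arrangements and unimodular maps\<close>

text \<open>Cells of a hyperplane arrangement, indexed by a point of the relative interior.\<close>

definition arr_cell :: "((real^'n) \<times> real) set \<Rightarrow> real^'n \<Rightarrow> (real^'n) set" where
  "arr_cell J y = {x. \<forall>(a, c)\<in>J. (a \<bullet> y \<le> c \<longrightarrow> a \<bullet> x \<le> c) \<and> (c \<le> a \<bullet> y \<longrightarrow> c \<le> a \<bullet> x)}"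

lemma arr_cellD:
  assumes "x \<in> arr_cell J y" "(a, c) \<in> J"
  shows "a \<bullet> y \<le> c \<Longrightarrow> a \<bullet> x \<le> c" "c \<le> a \<bullet> y \<Longrightarrow> c \<le> a \<bullet> x"
  using assms unfolding arr_cell_def by auto

lemma arr_cell_self [simp]: "y \<in> arr_cell J y"
  by (auto simp: arr_cell_def)

lemma arr_cell_eq:
  assumes "\<And>a c. (a, c) \<in> J \<Longrightarrow> (a \<bullet> y \<le> c \<longleftrightarrow> a \<bullet> z \<le> c) \<and> (c \<le> a \<bullet> y \<longleftrightarrow> c \<le> a \<bullet> z)"
  shows "arr_cell J y = arr_cell J z"
  using assms unfolding arr_cell_def by fastforce

lemma convex_arr_cell: "convex (arr_cell J y)"
proof -
  have "arr_cell J y = (\<Inter>(a, c)\<in>J. (if a \<bullet> y \<le> c then {x. a \<bullet> x \<le> c} else UNIV) \<inter>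
      (if c \<le> a \<bullet> y then {x. a \<bullet> x \<ge> c} else UNIV))"
    unfolding arr_cell_def by (auto split: if_splits)
  also have "convex \<dots>"
    by (intro convex_INT) (auto intro!: convex_Int convex_halfspace_le convex_halfspace_ge)
  finally show ?thesis .
qed

text \<open>A cell depends only on which of the weak inequalities hold at its index point, which
  leaves finitely many patterns.\<close>

lemma finite_range_arr_cell:
  assumes "finite J" shows "finite (range (arr_cell J))"
proof -
  let ?s = "\<lambda>y. ({(a, c)\<in>J. a \<bullet> y \<le> c}, {(a, c)\<in>J. c \<le> a \<bullet> y})"
  have "range (arr_cell J) \<subseteq> (\<lambda>(A, B). {x. (\<forall>(a, c)\<in>A. a \<bullet> x \<le> c) \<and> (\<forall>(a, c)\<in>B. c \<le> a \<bullet> x)}) ` (Pow J \<times> Pow J)"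
  proof
    fix X assume "X \<in> range (arr_cell J)"
    then obtain y where "X = arr_cell J y" by blast
    then have "X = (\<lambda>(A, B). {x. (\<forall>(a, c)\<in>A. a \<bullet> x \<le> c) \<and> (\<forall>(a, c)\<in>B. c \<le> a \<bullet> x)}) (?s y)"
      unfolding arr_cell_def by auto
    moreover have "?s y \<in> Pow J \<times> Pow J" by auto
    ultimately show "X \<in> (\<lambda>(A, B). {x. (\<forall>(a, c)\<in>A. a \<bullet> x \<le> c) \<and> (\<forall>(a, c)\<in>B. c \<le> a \<bullet> x)}) ` (Pow J \<times> Pow J)"
      by blast
  qed
  then show ?thesis using assms by (meson finite_Pow_iff finite_SigmaI finite_imageI finite_subset)
qed

lemma int_vec_uminus: "int_vec a \<Longrightarrow> int_vec (- a)"
  by (simp add: int_vec_def)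

lemma rational_polyhedron_arr_cell:
  assumes "finite J" "\<And>a c. (a, c) \<in> J \<Longrightarrow> int_vec a"
  shows "rational_polyhedron (arr_cell J y)"
proof -
  define F where "F = {(a, c)\<in>J. a \<bullet> y \<le> c} \<union> (\<lambda>(a, c). (- a, - c)) ` {(a, c)\<in>J. c \<le> a \<bullet> y}"
  have "finite F" unfolding F_def using assms(1)
    by (auto intro!: finite_imageI intro: finite_subset[of _ J])
  moreover have "\<forall>(a, c)\<in>F. int_vec a" unfolding F_def using assms(2) int_vec_uminus by auto
  moreover have "arr_cell J y = {x. \<forall>(a, c)\<in>F. a \<bullet> x \<le> c}"
  proof -
    have "(\<forall>(a, c)\<in>F. a \<bullet> x \<le> c) \<longleftrightarrow> (\<forall>(a, c)\<in>{(a, c)\<in>J. a \<bullet> y \<le> c}. a \<bullet> x \<le> c) \<and>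
      (\<forall>(a, c)\<in>{(a, c)\<in>J. c \<le> a \<bullet> y}. (- a) \<bullet> x \<le> - c)" for x
      unfolding F_def ball_Un by auto
    then show ?thesis unfolding arr_cell_def by auto
  qed
  ultimately show ?thesis unfolding rational_polyhedron_def by blast
qed

text \<open>On the cell of \<open>y\<close>, each inequality imposed by \<open>z\<close> either
  holds already or can hold only with equality. In the second case its hyperplane supports the cell
  of \<open>y\<close>, so it contains a segment of the cell as soon as it contains an inner point of
  the segment.\<close>

lemma arr_cell_Int_face:
  "(arr_cell J y \<inter> arr_cell J z) face_of arr_cell J y"
  unfolding face_of_def
proof (intro conjI ballI impI)
  show "convex (arr_cell J y \<inter> arr_cell J z)" by (intro convex_Int convex_arr_cell)
  fix u v x assume uv: "u \<in> arr_cell J y" "v \<in> arr_cell J y"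
    and x: "x \<in> arr_cell J y \<inter> arr_cell J z" "x \<in> open_segment u v"
  obtain t where t: "0 < t" "t < 1" "x = (1 - t) *\<^sub>R u + t *\<^sub>R v"
    using x(2) by (auto simp: in_segment)
  have ax: "a \<bullet> x - c = (1 - t) * (a \<bullet> u - c) + t * (a \<bullet> v - c)" for a c
    unfolding t(3) by (simp add: inner_add_right algebra_simps)
  have "u \<in> arr_cell J z \<and> v \<in> arr_cell J z"
  proof -
    have *: "(a \<bullet> z \<le> c \<longrightarrow> a \<bullet> u \<le> c \<and> a \<bullet> v \<le> c) \<and> (c \<le> a \<bullet> z \<longrightarrow> c \<le> a \<bullet> u \<and> c \<le> a \<bullet> v)"
      if J: "(a, c) \<in> J" for a c
    proof (intro conjI impI)
      have pos: "0 \<le> (1 - t) * w" "0 \<le> t * w" if "0 \<le> w" for w using t that by auto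
      have neg: "(1 - t) * w \<le> 0" "t * w \<le> 0" if "w \<le> 0" for w
        using t that by (auto simp: mult_le_0_iff)
      have nz: "(1 - t) * w = 0 \<longleftrightarrow> w = 0" "t * w = 0 \<longleftrightarrow> w = 0" for w using t by auto
      have le: "a \<bullet> u = c \<and> a \<bullet> v = c" if "a \<bullet> x \<le> c" "c \<le> a \<bullet> u" "c \<le> a \<bullet> v"
        using ax[of a c] pos[of "a \<bullet> u - c"] pos[of "a \<bullet> v - c"] nz[of "a \<bullet> u - c"] nz[of "a \<bullet> v - c"] that
        by linarith
      have ge: "a \<bullet> u = c \<and> a \<bullet> v = c" if "a \<bullet> x \<ge> c" "c \<ge> a \<bullet> u" "c \<ge> a \<bullet> v"
        using ax[of a c] neg[of "a \<bullet> u - c"] neg[of "a \<bullet> v - c"] nz[of "a \<bullet> u - c"] nz[of "a \<bullet> v - c"] that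
        by linarith
      note d = arr_cellD[OF uv(1) J] arr_cellD[OF uv(2) J]
      have "a \<bullet> u \<le> c \<and> a \<bullet> v \<le> c" if "a \<bullet> z \<le> c"
        using d(1,3) le[OF arr_cellD(1)[OF IntD2[OF x(1)] J that] d(2) d(4)] by force
      then show "a \<bullet> u \<le> c" "a \<bullet> v \<le> c" if "a \<bullet> z \<le> c" using that by auto
      have "c \<le> a \<bullet> u \<and> c \<le> a \<bullet> v" if "c \<le> a \<bullet> z"
        using d(2,4) ge[OF arr_cellD(2)[OF IntD2[OF x(1)] J that] d(1) d(3)] by force
      then show "c \<le> a \<bullet> u" "c \<le> a \<bullet> v" if "c \<le> a \<bullet> z" using that by auto
    qed
    then show ?thesis unfolding arr_cell_def by auto
  qed
  then show "u \<in> arr_cell J y \<inter> arr_cell J z" "v \<in> arr_cell J y \<inter> arr_cell J z" using uv by auto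
qed auto

lemma arr_cell_mono:
  assumes "z \<in> arr_cell J y" shows "arr_cell J z \<subseteq> arr_cell J y"
  using assms unfolding arr_cell_def by blast

text \<open>The index point is relatively interior in its cell: strict inequalities survive a small
  move, and an equality at \<open>y\<close> is an equality on the entire cell.\<close>

lemma arr_cell_prolong:
  assumes J: "finite J" and x: "x \<in> arr_cell J y"
  obtains e where "0 < e" "y + e *\<^sub>R (y - x) \<in> arr_cell J y"
proof -
  have "\<forall>\<^sub>F e in at_right 0. \<forall>(a, c)\<in>J. (a \<bullet> y \<le> c \<longrightarrow> a \<bullet> (y + e *\<^sub>R (y - x)) \<le> c) \<and>
      (c \<le> a \<bullet> y \<longrightarrow> c \<le> a \<bullet> (y + e *\<^sub>R (y - x)))"
  proof (intro eventually_ball_finite[OF J] ballI)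
    fix j assume j: "j \<in> J"
    obtain a c where ac: "j = (a, c)" by (cases j)
    have lim: "((\<lambda>e. a \<bullet> (y + e *\<^sub>R (y - x))) \<longlongrightarrow> a \<bullet> (y + 0 *\<^sub>R (y - x))) (at_right 0)"
      by (intro tendsto_intros)
    consider "a \<bullet> y < c" | "a \<bullet> y > c" | "a \<bullet> y = c" by linarith
    then have "\<forall>\<^sub>F e in at_right 0. (a \<bullet> y \<le> c \<longrightarrow> a \<bullet> (y + e *\<^sub>R (y - x)) \<le> c) \<and>
      (c \<le> a \<bullet> y \<longrightarrow> c \<le> a \<bullet> (y + e *\<^sub>R (y - x)))"
    proof cases
      case 1
      then have "\<forall>\<^sub>F e in at_right 0. a \<bullet> (y + e *\<^sub>R (y - x)) < c"
        using order_tendstoD(2)[OF lim] by simp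
      then show ?thesis by eventually_elim (use 1 in auto)
    next
      case 2
      then have "\<forall>\<^sub>F e in at_right 0. c < a \<bullet> (y + e *\<^sub>R (y - x))"
        using order_tendstoD(1)[OF lim] by simp
      then show ?thesis by eventually_elim (use 2 in auto)
    next
      case 3
      then have "a \<bullet> x = c" using arr_cellD[OF x j[unfolded ac]] by force
      then show ?thesis using 3 by (simp add: inner_add_right inner_diff_right)
    qed
    then show "\<forall>\<^sub>F e in at_right 0. case j of (a, c) \<Rightarrow> (a \<bullet> y \<le> c \<longrightarrow> a \<bullet> (y + e *\<^sub>R (y - x)) \<le> c) \<and>
      (c \<le> a \<bullet> y \<longrightarrow> c \<le> a \<bullet> (y + e *\<^sub>R (y - x)))" unfolding ac by simp
  qed
  moreover have "\<forall>\<^sub>F e in at_right (0::real). 0 < e" by (simp add: eventually_at_right_less)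
  ultimately have "\<forall>\<^sub>F e in at_right 0. 0 < e \<and> y + e *\<^sub>R (y - x) \<in> arr_cell J y"
    by eventually_elim (auto simp: arr_cell_def)
  then show ?thesis using that eventually_happens' trivial_limit_at_right_real by blast
qed

text \<open>A nonempty face is the cell of any point \<open>z\<close> of its relative interior. A
  point of that cell is joined through \<open>z\<close> to a point beyond, so the face property
  pulls it into \<open>F\<close>. Conversely \<open>F\<close> extends beyond \<open>z\<close>, so an
  inequality that is tight at \<open>z\<close> is tight on \<open>F\<close>.\<close>

lemma arr_cell_face:
  assumes J: "finite J" and F: "F face_of arr_cell J y" "F \<noteq> {}"
  shows "F \<in> range (arr_cell J)"
proof -
  have cF: "convex F" and sF: "F \<subseteq> arr_cell J y" using F(1) by (auto simp: face_of_def)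
  obtain z where z: "z \<in> rel_interior F"
    using rel_interior_eq_empty[OF cF] F(2) by blast
  have zF: "z \<in> F" using z rel_interior_subset by blast
  have zy: "z \<in> arr_cell J y" using zF sF by blast
  have "arr_cell J z \<subseteq> F"
  proof
    fix x assume x: "x \<in> arr_cell J z"
    show "x \<in> F"
    proof (cases "x = z")
      case False
      obtain e where e: "0 < e" "z + e *\<^sub>R (z - x) \<in> arr_cell J z" by (rule arr_cell_prolong[OF J x])
      define w where "w = z + e *\<^sub>R (z - x)"
      define t where "t = 1 / (1 + e)"
      have t: "0 < t" "t < 1" "t * (1 + e) = 1" unfolding t_def using e(1) by auto
      have "(1 - t) *\<^sub>R x + t *\<^sub>R w = z + (t * (1 + e) - 1) *\<^sub>R (z - x)"
        unfolding w_def by (simp add: algebra_simps)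
      then have "z = (1 - t) *\<^sub>R x + t *\<^sub>R w" unfolding t(3) by simp
      moreover have "x \<noteq> w"
      proof
        assume "x = w"
        then have "(1 + e) *\<^sub>R (z - x) = 0" unfolding w_def by (simp add: algebra_simps)
        then show False using e(1) False by auto
      qed
      ultimately have "z \<in> open_segment x w" unfolding in_segment using t by blast
      moreover have "x \<in> arr_cell J y" "w \<in> arr_cell J y"
        using arr_cell_mono[OF zy] x e(2) unfolding w_def by auto
      ultimately show ?thesis using F(1) zF unfolding face_of_def by blast
    qed (use zF in simp)
  qed
  moreover have "F \<subseteq> arr_cell J z"
  proof
    fix x assume x: "x \<in> F"
    obtain e where e: "1 < e" "(1 - e) *\<^sub>R x + e *\<^sub>R z \<in> F"
      using convex_rel_interior_iff[OF cF F(2)] z x by blast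
    define w where "w = (1 - e) *\<^sub>R x + e *\<^sub>R z"
    have aw: "a \<bullet> w - c = e * (a \<bullet> z - c) - (e - 1) * (a \<bullet> x - c)" for a c
      unfolding w_def by (simp add: inner_add_right algebra_simps)
    have "(a \<bullet> z \<le> c \<longrightarrow> a \<bullet> x \<le> c) \<and> (c \<le> a \<bullet> z \<longrightarrow> c \<le> a \<bullet> x)" if j: "(a, c) \<in> J" for a c
    proof -
      have X: "x \<in> arr_cell J y" "w \<in> arr_cell J y" using x e(2) sF unfolding w_def by auto
      note d = arr_cellD[OF X(1) j] arr_cellD[OF X(2) j] arr_cellD[OF zy j]
      have pos: "0 < (e - 1) * v" if "0 < v" for v using e that by auto
      have neg: "(e - 1) * v < 0" if "v < 0" for v using e that by (simp add: mult_less_0_iff)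
      consider "a \<bullet> z = c" | "a \<bullet> z < c" | "c < a \<bullet> z" by linarith
      then show ?thesis
      proof cases
        case 1
        then have w: "a \<bullet> w - c = - ((e - 1) * (a \<bullet> x - c))" using aw[of a c] by simp
        have "a \<bullet> x = c"
        proof (rule ccontr)
          assume "a \<bullet> x \<noteq> c"
          then show False
            using w pos[of "a \<bullet> x - c"] neg[of "a \<bullet> x - c"] d by linarith
        qed
        then show ?thesis by simp
      qed (use d in linarith)+
    qed
    then show "x \<in> arr_cell J z" unfolding arr_cell_def by auto
  qed
  ultimately show ?thesis by blast
qed

lemma polyhedral_complex_arrangement:
  assumes "finite J" "\<And>a c. (a, c) \<in> J \<Longrightarrow> int_vec a"
  shows "polyhedral_complex (range (arr_cell J))"
  unfolding polyhedral_complex_def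
proof (intro conjI ballI allI impI)
  show "finite (range (arr_cell J))" by (rule finite_range_arr_cell[OF assms(1)])
next
  fix \<sigma> assume "\<sigma> \<in> range (arr_cell J)"
  then obtain y where y: "\<sigma> = arr_cell J y" by blast
  show "rational_polyhedron \<sigma>" unfolding y by (rule rational_polyhedron_arr_cell[OF assms])
  show "\<sigma> \<noteq> {}" unfolding y using arr_cell_self by blast
  show "F \<in> range (arr_cell J)" if "F face_of \<sigma> \<and> F \<noteq> {}" for F
    using that unfolding y by (intro arr_cell_face[OF assms(1)]) auto
  fix \<tau> assume "\<tau> \<in> range (arr_cell J)"
  then obtain z where z: "\<tau> = arr_cell J z" by blast
  show "\<sigma> \<inter> \<tau> face_of \<sigma>" unfolding y z by (rule arr_cell_Int_face)
  show "\<sigma> \<inter> \<tau> face_of \<tau>" unfolding y z by (subst Int_commute) (rule arr_cell_Int_face)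
qed

text \<open>Points reached from \<open>x\<close> by a small move towards \<open>y\<close> have the
  sign pattern of \<open>y\<close>. A cell that meets an open set may thus be indexed by a point of
  that set, where local bounds apply.\<close>

lemma arr_cell_meets_open:
  assumes U: "open U" and x: "x \<in> U" "x \<in> arr_cell J y"
  obtains z where "z \<in> U" "arr_cell J z = arr_cell J y"
proof -
  have "((\<lambda>e. x + e *\<^sub>R (y - x)) \<longlongrightarrow> x + 0 *\<^sub>R (y - x)) (at_right 0)"
    by (intro tendsto_intros)
  then have "\<forall>\<^sub>F e in at_right 0. x + e *\<^sub>R (y - x) \<in> U"
    using U x(1) by (auto dest: topological_tendstoD)
  moreover have "\<forall>\<^sub>F e in at_right (0::real). 0 < e" by (simp add: eventually_at_right_less)
  moreover have "\<forall>\<^sub>F e in at_right (0::real). e < 1"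
    by (rule eventually_at_right_real[THEN eventually_mono, of 0 1]) auto
  ultimately have "\<forall>\<^sub>F e in at_right 0. 0 < e \<and> e < 1 \<and> x + e *\<^sub>R (y - x) \<in> U" by eventually_elim auto
  then obtain e where e: "0 < e" "e < 1" "x + e *\<^sub>R (y - x) \<in> U"
    using eventually_happens' trivial_limit_at_right_real by blast
  have "arr_cell J (x + e *\<^sub>R (y - x)) = arr_cell J y"
  proof (rule arr_cell_eq)
    fix a c assume j: "(a, c) \<in> J"
    have "a \<bullet> (x + e *\<^sub>R (y - x)) - c = (1 - e) * (a \<bullet> x - c) + e * (a \<bullet> y - c)"
      by (simp add: inner_add_right inner_diff_right algebra_simps)
    moreover have "(1 - e) * v \<ge> 0 \<longleftrightarrow> v \<ge> 0" "(1 - e) * v \<le> 0 \<longleftrightarrow> v \<le> 0"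
       "e * v \<le> 0 \<longleftrightarrow> v \<le> 0" "e * v \<ge> 0 \<longleftrightarrow> v \<ge> 0" for v
      using e by (auto simp: zero_le_mult_iff mult_le_0_iff)
    ultimately show "(a \<bullet> (x + e *\<^sub>R (y - x)) \<le> c \<longleftrightarrow> a \<bullet> y \<le> c) \<and> (c \<le> a \<bullet> (x + e *\<^sub>R (y - x)) \<longleftrightarrow> c \<le> a \<bullet> y)"
      using arr_cellD[OF x(2) j] le_iff_diff_le_0 diff_ge_0_iff_ge
      by (cases "a \<bullet> y \<le> c"; cases "c \<le> a \<bullet> y"; smt (verit, ccfv_threshold))
  qed
  then show ?thesis using that e by blast
qed

text \<open>Preserving and reflecting integrality covers all three conditions: a nonzero kernel
  vector could be scaled to a nonintegral one, and \<open>k y = A n\<close> puts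
  \<open>n / k\<close> into the lattice.\<close>

lemma unimodular_linearI:
  fixes A :: "real^'n^'m"
  assumes "\<And>v. int_vec (A *v v) \<longleftrightarrow> int_vec v"
  shows "unimodular_linear A"
  unfolding unimodular_linear_def
proof (intro conjI ballI allI impI)
  fix n :: "real^'n" assume "n \<in> Zpts" then show "int_vec (A *v n)" using assms by (simp add: Zpts_def)
next
  have ker: "v = 0" if "A *v v = 0" for v
  proof (rule ccontr)
    assume "v \<noteq> 0"
    then obtain i where i: "v $ i \<noteq> 0" by (auto simp: vec_eq_iff)
    have "A *v ((1 / (2 * v $ i)) *\<^sub>R v) = 0" by (simp only: that matrix_vector_mult_scaleR) simp
    then have "int_vec ((1 / (2 * v $ i)) *\<^sub>R v)"
      by (subst assms[symmetric]) (simp add: int_vec_def)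
    then have "(1 / 2 :: real) \<in> \<int>" using i by (auto simp: int_vec_def dest!: spec[of _ i])
    then obtain k where "1 / 2 = real_of_int k" by (auto elim: Ints_cases)
    then have "real_of_int (2 * k) = real_of_int 1" by simp
    then have "2 * k = 1" using of_int_eq_iff by blast
    then show False by presburger
  qed
  show "inj_on ((*v) A) Zpts"
    by (rule inj_onI) (metis ker matrix_vector_mult_diff_distrib eq_iff_diff_eq_0)
  fix y :: "real^'m" and k :: int
  assume y: "y \<in> Zpts" "k \<noteq> 0" "of_int k *\<^sub>R y \<in> (*v) A ` Zpts"
  then obtain n where n: "of_int k *\<^sub>R y = A *v n" by blast
  have "A *v ((1 / of_int k) *\<^sub>R n) = y"
    unfolding matrix_vector_mult_scaleR n[symmetric] using y(2) by simp
  then show "y \<in> (*v) A ` Zpts" using y(1) assms by (auto simp: Zpts_def)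
qed

section \<open>Selling reduction\<close>

lemma bform_pol_lambda: "bform Q x y = pol_lambda Q x \<bullet> y"
  by (simp add: bform_def pol_lambda_def dot_lmul_matrix)

lemma pol_lambda_linear:
  "pol_lambda Q (x + y) = pol_lambda Q x + pol_lambda Q y"
  "pol_lambda Q (c *\<^sub>R x) = c *\<^sub>R pol_lambda Q x"
  by (simp_all add: pol_lambda_def matrix_vector_right_distrib matrix_vector_mult_scaleR)

lemma bform_bilinear:
  "bform Q (x + y) z = bform Q x z + bform Q y z"
  "bform Q x (y + z) = bform Q x y + bform Q x z"
  "bform Q (c *\<^sub>R x) y = c * bform Q x y"
  "bform Q x (c *\<^sub>R y) = c * bform Q x y"
  by (simp_all add: bform_pol_lambda pol_lambda_linear inner_add_left inner_add_right)

lemma bform_sym: "transpose Q = Q \<Longrightarrow> bform Q x y = bform Q y x"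
  using bform_pol_lambda[of Q x y] by (simp add: bform_def pol_lambda_def inner_commute)

lemma bform_combination:
  assumes "transpose Q = Q"
  shows "bform Q (s *\<^sub>R g + t *\<^sub>R h) (s' *\<^sub>R g + t' *\<^sub>R h) =
    s * s' * bform Q g g + (s * t' + t * s') * bform Q g h + t * t' * bform Q h h"
  by (simp add: bform_bilinear bform_sym[OF assms, of h g] algebra_simps)

text \<open>An ordered basis with independence stated through coefficients, so that changes of basis
  become calculations with coefficients.\<close>

definition zbasis :: "(real^2) set \<Rightarrow> real^2 \<Rightarrow> real^2 \<Rightarrow> bool" where
  "zbasis L g h \<longleftrightarrow> (\<forall>s t. s *\<^sub>R g + t *\<^sub>R h = 0 \<longrightarrow> s = 0 \<and> t = 0) \<and>
     L = {of_int a *\<^sub>R g + of_int c *\<^sub>R h | a c. True}"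

lemma full_lattice_zbasis:
  assumes "full_lattice L"
  obtains g h where "zbasis L g h"
proof -
  obtain g h where gh: "g \<noteq> h" "independent {g, h}" "L = {of_int a *\<^sub>R g + of_int c *\<^sub>R h | a c. True}"
    using assms unfolding full_lattice_def by blast
  have ind: "g \<notin> span {h}" "h \<noteq> 0"
    using gh(1,2) by (auto simp: independent_insert)
  have "s = 0 \<and> t = 0" if "s *\<^sub>R g + t *\<^sub>R h = 0" for s t
  proof -
    have "s = 0"
    proof (rule ccontr)
      assume "s \<noteq> 0"
      have "s *\<^sub>R g = (- t) *\<^sub>R h" using that by (simp add: eq_neg_iff_add_eq_0)
      then have "(1 / s) *\<^sub>R (s *\<^sub>R g) = (1 / s) *\<^sub>R ((- t) *\<^sub>R h)" by simp
      then have "g = (- t / s) *\<^sub>R h" using \<open>s \<noteq> 0\<close> by simp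
      then show False using ind(1) by (metis span_base span_scale singletonI)
    qed
    then show ?thesis using that ind by auto
  qed
  then have "zbasis L g h" using gh(3) unfolding zbasis_def by blast
  then show ?thesis using that by blast
qed

lemma zbasis_mem: "zbasis L g h \<Longrightarrow> of_int a *\<^sub>R g + of_int c *\<^sub>R h \<in> L"
  unfolding zbasis_def by blast

lemma zbasis_cases:
  assumes "zbasis L g h" "u \<in> L"
  obtains a c :: int where "u = of_int a *\<^sub>R g + of_int c *\<^sub>R h"
  using assms unfolding zbasis_def by blast

lemma zbasis_unique:
  assumes "zbasis L g h" "s *\<^sub>R g + t *\<^sub>R h = s' *\<^sub>R g + t' *\<^sub>R h"
  shows "s = s'" "t = t'"
proof -
  have "(s - s') *\<^sub>R g + (t - t') *\<^sub>R h = 0" using assms(2) by (simp add: algebra_simps)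
  then have "s - s' = 0 \<and> t - t' = 0" using assms(1) unfolding zbasis_def by blast
  then show "s = s'" "t = t'" by auto
qed

lemma zbasis_spans:
  assumes "zbasis L g h"
  obtains s t where "x = s *\<^sub>R g + t *\<^sub>R h"
proof -
  let ?f = "\<lambda>v :: real^2. v $ 1 *\<^sub>R g + v $ 2 *\<^sub>R h"
  have lin: "linear ?f" by (rule linearI) (simp_all add: algebra_simps)
  have "inj ?f"
  proof (rule injI)
    fix v w assume "?f v = ?f w"
    from zbasis_unique[OF assms this] show "v = w" by (simp add: vec_eq_iff forall_2)
  qed
  then have "surj ?f" by (intro linear_injective_imp_surjective[OF lin]) auto
  from surjD[OF this, of x] obtain v where "x = ?f v" by (elim exE)
  then show ?thesis by (rule that)
qed

lemma zbasis_uminus: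
  assumes "zbasis L g h" shows "zbasis L g (- h)"
  unfolding zbasis_def
proof (intro conjI allI impI)
  show "s = 0" "t = 0" if "s *\<^sub>R g + t *\<^sub>R (- h) = 0" for s t
    using zbasis_unique[OF assms, of s "- t" 0 0] that by auto
  have "\<exists>a' c' :: int. of_int a *\<^sub>R g + of_int c *\<^sub>R h = of_int a' *\<^sub>R g + of_int c' *\<^sub>R (- h)" for a c :: int
    by (rule exI[of _ a], rule exI[of _ "- c"]) simp
  moreover have "\<exists>a' c' :: int. of_int a *\<^sub>R g + of_int c *\<^sub>R (- h) = of_int a' *\<^sub>R g + of_int c' *\<^sub>R h" for a c :: int
    by (rule exI[of _ a], rule exI[of _ "- c"]) simp
  ultimately show "L = {of_int a *\<^sub>R g + of_int c *\<^sub>R (- h) | a c. True}"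
    using assms unfolding zbasis_def by blast
qed

text \<open>Both pairs are consecutive in the superbase \<open>g, h, - (g + h)\<close>, any two
  members of which form a basis.\<close>

lemma zbasis_rotate:
  assumes "zbasis L g h" shows "zbasis L (- (g + h)) g"
  unfolding zbasis_def
proof (intro conjI allI impI)
  show "s = 0" "t = 0" if "s *\<^sub>R (- (g + h)) + t *\<^sub>R g = 0" for s t
  proof -
    have "(t - s) *\<^sub>R g + (- s) *\<^sub>R h = 0 *\<^sub>R g + 0 *\<^sub>R h" using that by (simp add: algebra_simps)
    from zbasis_unique[OF assms this] show "s = 0" "t = 0" by auto
  qed
  have "\<exists>a' c' :: int. of_int a *\<^sub>R g + of_int c *\<^sub>R h = of_int a' *\<^sub>R (- (g + h)) + of_int c' *\<^sub>R g" for a c :: int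
    by (rule exI[of _ "- c"], rule exI[of _ "a - c"]) (simp add: algebra_simps)
  moreover have "\<exists>a' c' :: int. of_int a *\<^sub>R (- (g + h)) + of_int c *\<^sub>R g = of_int a' *\<^sub>R g + of_int c' *\<^sub>R h" for a c :: int
    by (rule exI[of _ "c - a"], rule exI[of _ "- a"]) (simp add: algebra_simps)
  ultimately show "L = {of_int a *\<^sub>R (- (g + h)) + of_int c *\<^sub>R g | a c. True}"
    using assms unfolding zbasis_def by blast
qed

lemma finite_int_square_le:
  fixes D B :: real assumes "0 < D"
  shows "finite {m :: int. D * (of_int m)\<^sup>2 \<le> B}"
proof (rule finite_subset)
  show "{m :: int. D * (of_int m)\<^sup>2 \<le> B} \<subseteq> {- \<lceil>B / D\<rceil>..\<lceil>B / D\<rceil>}"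
  proof
    fix m :: int assume "m \<in> {m. D * (of_int m)\<^sup>2 \<le> B}"
    then have "real_of_int (m\<^sup>2) \<le> B / D" using assms by (simp add: field_simps)
    then have "m\<^sup>2 \<le> \<lceil>B / D\<rceil>" using le_of_int_ceiling[of "B / D"] by linarith
    moreover have "\<bar>m\<bar> \<le> m\<^sup>2" using self_le_power[of "\<bar>m\<bar>" 2] by (cases "m = 0") auto
    ultimately show "m \<in> {- \<lceil>B / D\<rceil>..\<lceil>B / D\<rceil>}" by auto
  qed
qed simp

text \<open>Completing the square gives \<open>c Q(v) = D m^2 + (b m + c n)^2\<close> and the
  analogue for \<open>n\<close>, so both coordinates of a short vector are bounded.\<close>

lemma finite_short_vectors:
  assumes sym: "transpose Q = Q" and pd: "\<And>x. x \<noteq> 0 \<Longrightarrow> bform Q x x > 0" and zb: "zbasis L g h"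
  shows "finite {v \<in> L. bform Q v v \<le> K}"
proof -
  define a b c where "a = bform Q g g" and "b = bform Q g h" and "c = bform Q h h"
  define D where "D = a * c - b\<^sup>2"
  have ind: "s = 0 \<and> t = 0" if "s *\<^sub>R g + t *\<^sub>R h = 0" for s t using that zb unfolding zbasis_def by blast
  have "g \<noteq> 0" "h \<noteq> 0" using ind[of 1 0] ind[of 0 1] by auto
  then have ac: "a > 0" "c > 0" using pd unfolding a_def c_def by auto
  have Qv: "bform Q (s *\<^sub>R g + t *\<^sub>R h) (s *\<^sub>R g + t *\<^sub>R h) = a * s\<^sup>2 + 2 * b * s * t + c * t\<^sup>2" for s t
    unfolding bform_combination[OF sym] a_def b_def c_def by (simp add: power2_eq_square algebra_simps)
  \<comment> \<open>The vector \<open>c g - b h\<close> is orthogonal to \<open>h\<close> and has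
    square \<open>c D\<close>, which gives \<open>D > 0\<close>.\<close>
  have "c *\<^sub>R g + (- b) *\<^sub>R h \<noteq> 0" using ind[of c "- b"] ac by auto
  from pd[OF this] have "c * D > 0" unfolding Qv D_def by (simp add: power2_eq_square algebra_simps)
  then have D: "D > 0" using ac by (simp add: zero_less_mult_iff)
  let ?A = "{m :: int. D * (of_int m)\<^sup>2 \<le> c * K}" and ?B = "{m :: int. D * (of_int m)\<^sup>2 \<le> a * K}"
  have "{v \<in> L. bform Q v v \<le> K} \<subseteq> (\<lambda>(m, n). of_int m *\<^sub>R g + of_int n *\<^sub>R h) ` (?A \<times> ?B)"
  proof
    fix v assume v: "v \<in> {v \<in> L. bform Q v v \<le> K}"
    then obtain m n :: int where mn: "v = of_int m *\<^sub>R g + of_int n *\<^sub>R h"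
      using zbasis_cases[OF zb] by blast
    have K: "a * (of_int m)\<^sup>2 + 2 * b * of_int m * of_int n + c * (of_int n)\<^sup>2 \<le> K"
      using v unfolding mn by (simp add: Qv)
    let ?m = "real_of_int m" and ?n = "real_of_int n"
    have "D * ?m\<^sup>2 \<le> D * ?m\<^sup>2 + (b * ?m + c * ?n)\<^sup>2" by simp
    also have "\<dots> = c * (a * ?m\<^sup>2 + 2 * b * ?m * ?n + c * ?n\<^sup>2)"
      unfolding D_def by (simp add: power2_eq_square algebra_simps)
    also have "\<dots> \<le> c * K" using K ac by (intro mult_left_mono) auto
    finally have 1: "m \<in> ?A" by simp
    have "D * ?n\<^sup>2 \<le> D * ?n\<^sup>2 + (a * ?m + b * ?n)\<^sup>2" by simp
    also have "\<dots> = a * (a * ?m\<^sup>2 + 2 * b * ?m * ?n + c * ?n\<^sup>2)"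
      unfolding D_def by (simp add: power2_eq_square algebra_simps)
    also have "\<dots> \<le> a * K" using K ac by (intro mult_left_mono) auto
    finally have "n \<in> ?B" by simp
    with 1 show "v \<in> (\<lambda>(m, n). of_int m *\<^sub>R g + of_int n *\<^sub>R h) ` (?A \<times> ?B)" unfolding mn by auto
  qed
  moreover have "finite (?A \<times> ?B)" using finite_int_square_le[OF D] by blast
  ultimately show ?thesis by (meson finite_imageI finite_subset)
qed

text \<open>Selling reduction: a basis minimising \<open>Q(g) + Q(h) + Q(g + h)\<close> is an obtuse superbase, since
  replacing \<open>h\<close> by \<open>- h\<close> changes the sum by \<open>- 4 Q(g, h)\<close> and rotating \<open>(g, h, - g - h)\<close> preserves it.\<close>

lemma obtuse_superbase_exists:
  assumes sym: "transpose Q = Q" and pd: "\<And>x. x \<noteq> 0 \<Longrightarrow> bform Q x x > 0" and zb: "zbasis L g0 h0"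
  obtains g h where "zbasis L g h" "bform Q g h \<le> 0" "bform Q g (g + h) \<ge> 0" "bform Q h (g + h) \<ge> 0"
proof -
  define S where "S = (\<lambda>(g, h). bform Q g g + bform Q h h + bform Q (g + h) (g + h))"
  define K where "K = S (g0, h0)"
  \<comment> \<open>The minimum is sought among the bases not worse than the given one. Both members
    of such a basis have square at most \<open>K\<close>, so there are finitely many.\<close>
  define X where "X = {(g, h). zbasis L g h \<and> S (g, h) \<le> K}"
  have nn: "bform Q x x \<ge> 0" for x using pd[of x] by (cases "x = 0") (auto simp: bform_def)
  have in_L: "g \<in> L" "h \<in> L" if "zbasis L g h" for g h
    using zbasis_mem[OF that, of 1 0] zbasis_mem[OF that, of 0 1] by auto
  have "X \<subseteq> {v \<in> L. bform Q v v \<le> K} \<times> {v \<in> L. bform Q v v \<le> K}"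
  proof (rule subrelI)
    fix g h assume "(g, h) \<in> X"
    then have z: "zbasis L g h" "S (g, h) \<le> K" unfolding X_def by auto
    then show "(g, h) \<in> {v \<in> L. bform Q v v \<le> K} \<times> {v \<in> L. bform Q v v \<le> K}"
      using in_L[OF z(1)] nn[of g] nn[of h] nn[of "g + h"] unfolding S_def by auto
  qed
  then have "finite X"
    using finite_short_vectors[OF sym pd zb] by (meson finite_SigmaI finite_subset)
  moreover have "X \<noteq> {}" using zb unfolding X_def K_def by auto
  ultimately obtain gh where "is_arg_min S (\<lambda>x. x \<in> X) gh"
    using ex_is_arg_min_if_finite by blast
  then obtain g h where gh: "(g, h) \<in> X" and m: "\<And>x. x \<in> X \<Longrightarrow> S (g, h) \<le> S x"
    unfolding is_arg_min_linorder by (cases gh) auto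
  have zgh: "zbasis L g h" using gh unfolding X_def by simp
  have min: "S (g, h) \<le> S (g', h')" if "zbasis L g' h'" for g' h'
    using m[of "(g', h')"] gh that unfolding X_def by fastforce
  have neg: "bform Q (- x) y = - bform Q x y" "bform Q x (- y) = - bform Q x y" for x y
    using bform_bilinear(3)[of Q "-1" x y] bform_bilinear(4)[of Q x "-1" y] by auto
  have key: "bform Q g' h' \<le> 0" if z: "zbasis L g' h'" and S: "S (g', h') = S (g, h)" for g' h'
  proof -
    have "S (g', - h') = S (g', h') - 4 * bform Q g' h'"
      unfolding S_def by (simp only: prod.case neg bform_bilinear) (simp add: bform_sym[OF sym, of h' g'])
    then show ?thesis using min[OF zbasis_uminus[OF z]] S by linarith
  qed
  have rot: "S (- (g' + h'), g') = S (g', h')" for g' h'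
    unfolding S_def by (simp only: prod.case neg bform_bilinear minus_add_distrib)
  \<comment> \<open>The sign condition \<open>key\<close> is applied to the three consecutive pairs
    of the superbase, which by \<open>rot\<close> share the minimal sum.\<close>
  have z1: "zbasis L (- (g + h)) g" by (rule zbasis_rotate[OF zgh])
  have "- (- (g + h) + g) = h" by simp
  with zbasis_rotate[OF z1] have z2: "zbasis L h (- (g + h))" by simp
  have S2: "S (h, - (g + h)) = S (g, h)" using rot[of "- (g + h)" g] rot[of g h] by simp
  show ?thesis
  proof (rule that[OF zgh])
    show "bform Q g h \<le> 0" by (rule key[OF zgh refl])
    show "bform Q g (g + h) \<ge> 0" 
      using key[OF z1 rot] bform_sym[OF sym, of "g + h" g] unfolding neg by linarith
    show "bform Q h (g + h) \<ge> 0" using key[OF z2 S2] unfolding neg by linarith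
  qed
qed

text \<open>Principality makes the images of \<open>g\<close> and \<open>h\<close> a basis of M, and
  N is the dual of M, so integrality can be tested on these two functionals.\<close>

lemma int_vec_dual_basis:
  assumes pr: "principal L Q" and zb: "zbasis L g h"
  shows "int_vec v \<longleftrightarrow> pol_lambda Q g \<bullet> v \<in> \<int> \<and> pol_lambda Q h \<bullet> v \<in> \<int>"
proof
  have im: "pol_lambda Q ` L = Zpts" using pr unfolding principal_def bij_betw_def by blast
  have iv: "int_vec (pol_lambda Q g)" "int_vec (pol_lambda Q h)"
    using im zbasis_mem[OF zb, of 1 0] zbasis_mem[OF zb, of 0 1] by (auto simp: Zpts_def)
  have "w \<bullet> v \<in> \<int>" if "int_vec w" "int_vec v" for w :: "real^2"
    using that by (auto simp: inner_vec_def int_vec_def intro!: Ints_sum Ints_mult)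
  then show "int_vec v \<Longrightarrow> pol_lambda Q g \<bullet> v \<in> \<int> \<and> pol_lambda Q h \<bullet> v \<in> \<int>" using iv by blast
  assume v: "pol_lambda Q g \<bullet> v \<in> \<int> \<and> pol_lambda Q h \<bullet> v \<in> \<int>"
  show "int_vec v" unfolding int_vec_def
  proof
    fix i :: 2
    have "axis i 1 \<in> (Zpts :: (real^2) set)" by (auto simp: Zpts_def int_vec_def axis_def)
    then obtain u where u: "u \<in> L" "axis i 1 = pol_lambda Q u" using im by blast
    obtain m n :: int where "u = of_int m *\<^sub>R g + of_int n *\<^sub>R h" using zbasis_cases[OF zb u(1)] .
    then have "v $ i = of_int m * (pol_lambda Q g \<bullet> v) + of_int n * (pol_lambda Q h \<bullet> v)"
      using u(2) by (metis inner_axis' inner_add_left inner_scaleR_left pol_lambda_linear mult_1 real_inner_1_left inner_real_def)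
    then show "v $ i \<in> \<int>" using v by simp
  qed
qed

text \<open>By \<open>int_vec_dual_basis\<close> the map \<open>x -> (Q(g, x), Q(h, x))\<close> is
  an isomorphism from N to the integral points. Orthogonality sends \<open>g\<close> and
  \<open>h\<close> to multiples \<open>l1\<close> and \<open>l2\<close> of the coordinate vectors,
  and the form becomes diagonal with entries \<open>1 / l1\<close> and
  \<open>1 / l2\<close>.\<close>

lemma product_type_if_orthogonal:
  assumes sym: "transpose Q = Q" and pd: "\<And>x. x \<noteq> 0 \<Longrightarrow> bform Q x x > 0" and pr: "principal L Q"
    and zb: "zbasis L g h" and orth: "bform Q g h = 0"
  shows "product_type L Q"
proof -
  define H :: "real^2^2" where "H = vector [pol_lambda Q g, pol_lambda Q h]"
  define l1 l2 where "l1 = bform Q g g" and "l2 = bform Q h h"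
  have H1: "(H *v x) $ 1 = bform Q g x" and H2: "(H *v x) $ 2 = bform Q h x" for x
    by (simp_all add: H_def matrix_vector_mul_component bform_pol_lambda)
  have orth': "bform Q h g = 0" using orth bform_sym[OF sym] by metis
  have Hc: "bform Q g (s *\<^sub>R g + t *\<^sub>R h) = s * l1" "bform Q h (s *\<^sub>R g + t *\<^sub>R h) = t * l2" for s t
    by (simp_all add: bform_bilinear orth orth' l1_def l2_def)
  have "g \<noteq> 0" "h \<noteq> 0"
    using zbasis_unique[OF zb, of 1 0 0 0] zbasis_unique[OF zb, of 0 1 0 0] by auto
  then have l: "l1 > 0" "l2 > 0" using pd unfolding l1_def l2_def by auto
  have inj: "inj ((*v) H)"
  proof (rule injI)
    fix x y assume "H *v x = H *v y"
    then have e: "bform Q g x = bform Q g y" "bform Q h x = bform Q h y" using H1 H2 by metis+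
    obtain s t where x: "x = s *\<^sub>R g + t *\<^sub>R h" using zbasis_spans[OF zb] .
    obtain s' t' where y: "y = s' *\<^sub>R g + t' *\<^sub>R h" using zbasis_spans[OF zb] .
    show "x = y" using e l unfolding x y Hc by simp
  qed
  have iv: "int_vec (H *v v) \<longleftrightarrow> int_vec v" for v
    unfolding int_vec_dual_basis[OF pr zb, of v] by (simp add: int_vec_def forall_2 H1 H2 bform_pol_lambda)
  have "surj ((*v) H)" using inj by (intro linear_injective_imp_surjective) auto
  then have Zp: "(*v) H ` Zpts = Zpts" using iv unfolding Zpts_def by (auto simp: image_iff) (metis surjD)
  have HL: "(*v) H ` L = {v. \<exists>a c :: int. v $ 1 = of_int a * l1 \<and> v $ 2 = of_int c * l2}"
  proof (intro equalityI subsetI)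
    fix v assume "v \<in> (*v) H ` L"
    then obtain u where u: "u \<in> L" "v = H *v u" by blast
    obtain a c :: int where "u = of_int a *\<^sub>R g + of_int c *\<^sub>R h" using zbasis_cases[OF zb u(1)] .
    then show "v \<in> {v. \<exists>a c :: int. v $ 1 = of_int a * l1 \<and> v $ 2 = of_int c * l2}"
      unfolding u(2) by (auto simp: H1 H2 Hc)
  next
    fix v assume "v \<in> {v :: real^2. \<exists>a c :: int. v $ 1 = of_int a * l1 \<and> v $ 2 = of_int c * l2}"
    then obtain a c :: int where "v $ 1 = of_int a * l1" "v $ 2 = of_int c * l2" by blast
    then have "v = H *v (of_int a *\<^sub>R g + of_int c *\<^sub>R h)" by (simp add: vec_eq_iff forall_2 H1 H2 Hc)
    then show "v \<in> (*v) H ` L" using zbasis_mem[OF zb] by blast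
  qed
  have "bform Q x y = 1 / l1 * (H *v x) $ 1 * (H *v y) $ 1 + 1 / l2 * (H *v x) $ 2 * (H *v y) $ 2" for x y
  proof -
    obtain s t where x: "x = s *\<^sub>R g + t *\<^sub>R h" using zbasis_spans[OF zb] .
    obtain s' t' where y: "y = s' *\<^sub>R g + t' *\<^sub>R h" using zbasis_spans[OF zb] .
    show ?thesis unfolding H1 H2 unfolding x y Hc bform_combination[OF sym] orth
      using l by (simp add: l1_def[symmetric] l2_def[symmetric])
  qed
  then show ?thesis unfolding product_type_def
    using inj Zp HL l
    by (intro exI[of _ H] exI[of _ l1] exI[of _ l2] exI[of _ "1 / l1"] exI[of _ "1 / l2"] conjI allI) auto
qed

section \<open>Theta functions in a Selling reduced basis\<close>

text \<open>The Gram matrix says \<open>Q(s g + t h) = sform p q r s t\<close>. Strict positivity of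
  the three parameters is how irreducibility enters.\<close>

locale selling_basis =
  fixes L :: "(real^2) set" and Q :: "real^2^2" and g h :: "real^2" and p q r :: real
  assumes sym: "transpose Q = Q" and pd: "\<And>x. x \<noteq> 0 \<Longrightarrow> bform Q x x > 0"
    and pr: "principal L Q" and zb: "zbasis L g h"
    and pos: "0 < p" "0 < q" "0 < r"
    and gram: "bform Q g g = p + r" "bform Q g h = - r" "bform Q h h = q + r"
begin

definition comb :: "real \<Rightarrow> real \<Rightarrow> real^2" where
  "comb s t = s *\<^sub>R g + t *\<^sub>R h"

text \<open>The coordinates \<open>(y, z)\<close> of \<open>x\<close> are chosen such that the theta terms of \<open>x\<close> become squared
  distances from \<open>(y, z)\<close> to integral points, up to a common summand.\<close>

definition pt :: "real \<Rightarrow> real \<Rightarrow> real^2" where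
  "pt y z = comb (- y / 2) (- z / 2)"

definition chr :: "int \<Rightarrow> int \<Rightarrow> real^2" where
  "chr k l = pol_lambda Q (comb (of_int k) (of_int l))"

text \<open>This is the theta term of the vector \<open>w = (k g + l h) / 2\<close>; the class
  representative and the lattice vector enter only through \<open>k\<close> and
  \<open>l\<close>.\<close>

definition trm :: "int \<Rightarrow> int \<Rightarrow> real^2 \<Rightarrow> real" where
  "trm k l x = chr k l \<bullet> x + sform p q r (of_int k) (of_int l) / 4"

lemma bform_comb:
  "bform Q (comb s t) (comb s' t') = p * s * s' + q * t * t' + r * (s - t) * (s' - t')"
  unfolding comb_def bform_combination[OF sym] gram by (simp add: algebra_simps)

lemma bform_comb_self: "bform Q (comb s t) (comb s t) = sform p q r s t"
  unfolding bform_comb sform_def by (simp add: power2_eq_square algebra_simps)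

lemma comb_simps:
  "comb s t + comb s' t' = comb (s + s') (t + t')" "c *\<^sub>R comb s t = comb (c * s) (c * t)"
  "comb s t - comb s' t' = comb (s - s') (t - t')" "- comb s t = comb (- s) (- t)"
  by (simp_all add: comb_def algebra_simps)

lemma comb_mem: "comb (of_int a) (of_int c) \<in> L"
  unfolding comb_def by (rule zbasis_mem[OF zb])

lemma comb_cases:
  assumes "u \<in> L" obtains a c :: int where "u = comb (of_int a) (of_int c)"
  using zbasis_cases[OF zb assms] unfolding comb_def by blast

lemma comb_inject: "comb s t = comb s' t' \<longleftrightarrow> s = s' \<and> t = t'"
  using zbasis_unique[OF zb] unfolding comb_def by blast

lemma pt_cases: obtains y z where "x = pt y z"
proof -
  obtain s t where "x = s *\<^sub>R g + t *\<^sub>R h" using zbasis_spans[OF zb] .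
  then have "x = pt (- 2 * s) (- 2 * t)" by (simp add: pt_def comb_def)
  then show ?thesis by (rule that)
qed

text \<open>Completing the square. The subtracted \<open>sform p q r y z\<close> does not involve
  \<open>k\<close> and \<open>l\<close>, so comparing theta terms is comparing distances.\<close>

lemma trm_pt:
  "trm k l (pt y z) = (sform p q r (of_int k - y) (of_int l - z) - sform p q r y z) / 4"
  unfolding trm_def chr_def pt_def bform_pol_lambda[symmetric] bform_comb sform_def
  by (simp add: power2_eq_square diff_divide_distrib add_divide_distrib algebra_simps)

lemma trm_le_iff:
  "trm k l (pt y z) \<le> trm k' l' (pt y z) \<longleftrightarrow>
    sform p q r (of_int k - y) (of_int l - z) \<le> sform p q r (of_int k' - y) (of_int l' - z)"
  unfolding trm_pt by (simp add: divide_le_cancel)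

lemma chr_simps:
  "chr k l + chr k' l' = chr (k + k') (l + l')" "chr k l - chr k' l' = chr (k - k') (l - l')"
proof -
  show *: "chr k l + chr k' l' = chr (k + k') (l + l')" for k l k' l'
    unfolding chr_def pol_lambda_linear(1)[symmetric] comb_simps by simp
  show "chr k l - chr k' l' = chr (k - k') (l - l')"
    using *[of "k - k'" "l - l'" k' l'] by (simp add: diff_eq_eq)
qed

lemma chr_eq: "chr k l = of_int k *\<^sub>R pol_lambda Q g + of_int l *\<^sub>R pol_lambda Q h"
  unfolding chr_def comb_def pol_lambda_linear ..

lemma pol_lambda_image: "pol_lambda Q ` L = Zpts"
  using pr unfolding principal_def bij_betw_def by blast

lemma chr_int_vec: "int_vec (chr k l)"
  using pol_lambda_image comb_mem unfolding chr_def Zpts_def by blast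

lemma chr_cases:
  assumes "b \<in> Zpts" obtains m n where "b = chr m n"
proof -
  obtain u where u: "u \<in> L" "b = pol_lambda Q u" using assms pol_lambda_image by blast
  obtain m n :: int where "u = comb (of_int m) (of_int n)" by (rule comb_cases[OF u(1)])
  then show ?thesis using that[of m n] u unfolding chr_def by simp
qed

lemma pol_lambda_inj: "inj (pol_lambda Q)"
proof (rule injI)
  fix x y assume "pol_lambda Q x = pol_lambda Q y"
  then have "pol_lambda Q (x - y) = 0"
    by (simp add: pol_lambda_def matrix_vector_mult_diff_distrib)
  then have "bform Q (x - y) (x - y) = 0" by (simp add: bform_pol_lambda)
  then show "x = y" using pd[of "x - y"] by auto
qed

lemma half_lambda_inv_chr: "half_lambda_inv Q (chr m n) = comb (of_int m / 2) (of_int n / 2)"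
  unfolding half_lambda_inv_def
proof (rule inv_f_eq)
  show "inj (\<lambda>x. 2 *\<^sub>R pol_lambda Q x)" using pol_lambda_inj by (auto simp: inj_def)
  show "2 *\<^sub>R pol_lambda Q (comb (of_int m / 2) (of_int n / 2)) = chr m n"
    unfolding chr_def pol_lambda_linear(2)[symmetric] comb_simps by simp
qed

text \<open>As the lattice vector varies, \<open>(2 i + m, 2 j + n)\<close> runs through the class
  of \<open>(m, n)\<close> modulo 2, which turns the infimum into a nearest point problem.\<close>

lemma theta_term_eq:
  "theta_term Q (chr m n) x (comb (of_int i) (of_int j)) = trm (2 * i + m) (2 * j + n) x"
proof -
  define w where "w = comb (of_int (2 * i + m)) (of_int (2 * j + n))"
  have "comb (of_int i) (of_int j) + half_lambda_inv Q (chr m n) = (1 / 2) *\<^sub>R w"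
    unfolding half_lambda_inv_chr comb_simps w_def by (simp add: add_divide_distrib)
  then have "theta_term Q (chr m n) x (comb (of_int i) (of_int j)) = bform Q x w + bform Q w w / 4"
    unfolding theta_term_def Let_def by (simp only: bform_bilinear)
  also have "\<dots> = trm (2 * i + m) (2 * j + n) x"
    unfolding bform_sym[OF sym, of x w] trm_def chr_def
    unfolding bform_pol_lambda w_def bform_comb_self[unfolded bform_pol_lambda] ..
  finally show ?thesis .
qed

lemma theta_attained:
  assumes "nearest p q r y z k l" "even (k - m)" "even (l - n)"
  defines "u \<equiv> comb (of_int ((k - m) div 2)) (of_int ((l - n) div 2))"
  shows "u \<in> L" "theta_term Q (chr m n) (pt y z) u = trm k l (pt y z)"
    "\<And>v. v \<in> L \<Longrightarrow> theta_term Q (chr m n) (pt y z) u \<le> theta_term Q (chr m n) (pt y z) v"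
    "theta L Q (chr m n) (pt y z) = trm k l (pt y z)"
proof -
  show uL: "u \<in> L" unfolding u_def by (rule comb_mem)
  have "2 * ((k - m) div 2) + m = k" "2 * ((l - n) div 2) + n = l" using assms(2,3) by auto
  then show tu: "theta_term Q (chr m n) (pt y z) u = trm k l (pt y z)"
    unfolding u_def theta_term_eq by simp
  show min: "theta_term Q (chr m n) (pt y z) u \<le> theta_term Q (chr m n) (pt y z) v" if v: "v \<in> L" for v
  proof -
    obtain i j :: int where ij: "v = comb (of_int i) (of_int j)" by (rule comb_cases[OF v])
    have "even ((2 * i + m) - k)" "even ((2 * j + n) - l)" using assms(2,3) by auto
    then show ?thesis using assms(1) unfolding tu ij theta_term_eq trm_le_iff nearest_def by blast
  qed
  show "theta L Q (chr m n) (pt y z) = trm k l (pt y z)"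
    unfolding theta_def tu[symmetric] using uL min by (intro cInf_eq_minimum) auto
qed

lemma theta_pt:
  assumes "nearest p q r y z k l" "even (k - m)" "even (l - n)"
  shows "theta L Q (chr m n) (pt y z) = (sform p q r (of_int k - y) (of_int l - z) - sform p q r y z) / 4"
  unfolding theta_attained(4)[OF assms] trm_pt ..

lemma pt_simps:
  "- pt y z = pt (- y) (- z)" "pt y z - pt y' z' = pt (y - y') (z - z')"
  "pt y z + pt y' z' = pt (y + y') (z + z')"
  "pt y z + comb (of_int a) (of_int c) = pt (y - of_int (2 * a)) (z - of_int (2 * c))"
  by (simp_all add: pt_def comb_simps comb_inject field_simps)

lemma pt_mem_L: "pt (2 * of_int m) (2 * of_int n) \<in> L"
  using comb_mem[of "- m" "- n"] by (simp add: pt_def)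

section \<open>Minima, descent to the quotient and injectivity\<close>

lemma theta_min_exists:
  assumes "b \<in> Zpts"
  shows "\<exists>u\<in>L. theta L Q b x = theta_term Q b x u \<and> (\<forall>v\<in>L. theta_term Q b x u \<le> theta_term Q b x v)"
proof -
  obtain m n where b: "b = chr m n" by (rule chr_cases[OF assms])
  obtain y z where x: "x = pt y z" by (rule pt_cases)
  obtain k l where "nearest p q r y z k l" "even (k - m)" "even (l - n)"
    by (rule nearest_exists_bounded[OF pos])
  from theta_attained[OF this] show ?thesis unfolding b x by metis
qed

text \<open>A lattice translation moves \<open>(y, z)\<close> by even integers and so preserves
  every class modulo 2. Distances are unchanged and only the common summand varies.\<close>

lemma theta_translate:
  assumes "u \<in> L" shows "\<exists>t. \<forall>b\<in>Zpts. theta L Q b (x + u) = theta L Q b x + t"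
proof -
  obtain a c :: int where u: "u = comb (of_int a) (of_int c)" by (rule comb_cases[OF assms])
  obtain y z where x: "x = pt y z" by (rule pt_cases)
  let ?y = "y + of_int (- (2 * a))" and ?z = "z + of_int (- (2 * c))"
  have xu: "x + u = pt ?y ?z" unfolding x u pt_simps by simp
  have "theta L Q b (x + u) = theta L Q b x + (sform p q r y z - sform p q r ?y ?z) / 4"
    if bZ: "b \<in> Zpts" for b
  proof -
    obtain m n where b: "b = chr m n" by (rule chr_cases[OF bZ])
    obtain k l where kl: "nearest p q r y z k l" "even (k - m)" "even (l - n)"
      by (rule nearest_exists_bounded[OF pos])
    have e: "even (k + - (2 * a) - m)" "even (l + - (2 * c) - n)" using kl by auto
    show ?thesis
      unfolding xu b theta_pt[OF nearest_shift[OF kl(1)] e] unfolding x theta_pt[OF kl]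
      by (simp add: diff_divide_distrib)
  qed
  then show ?thesis by blast
qed

text \<open>Reflection maps each class modulo 2 to itself, since \<open>k\<close> and
  \<open>- k\<close> are congruent. The common summand is even in \<open>(y, z)\<close>, so no
  constant appears.\<close>

lemma theta_uminus:
  assumes "b \<in> Zpts" shows "theta L Q b (- x) = theta L Q b x"
proof -
  obtain m n where b: "b = chr m n" by (rule chr_cases[OF assms])
  obtain y z where x: "x = pt y z" by (rule pt_cases)
  obtain k l where kl: "nearest p q r y z k l" "even (k - m)" "even (l - n)"
    by (rule nearest_exists_bounded[OF pos])
  have e: "even (- k - m)" "even (- l - n)" using kl by auto
  have "sform p q r (of_int (- k) - - y) (of_int (- l) - - z) = sform p q r (of_int k - y) (of_int l - z)"
    using sform_uminus[of p q r "of_int k - y" "of_int l - z"] by simp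
  then show ?thesis
    unfolding x b pt_simps theta_pt[OF kl] theta_pt[OF nearest_uminus[OF kl(1)] e] by simp
qed

lemma theta_injective:
  assumes B: "B \<subseteq> Zpts" and complete: "\<And>k l. \<exists>m n. chr m n \<in> B \<and> even (k - m) \<and> even (l - n)"
    and eq: "\<And>b. b \<in> B \<Longrightarrow> theta L Q b x = theta L Q b x' + t"
  shows "x - x' \<in> L \<or> x + x' \<in> L"
proof -
  obtain y z where x: "x = pt y z" by (rule pt_cases)
  obtain y' z' where x': "x' = pt y' z'" by (rule pt_cases)
  have "(\<exists>m n :: int. y - y' = 2 * of_int m \<and> z - z' = 2 * of_int n) \<or>
    (\<exists>m n :: int. y + y' = 2 * of_int m \<and> z + z' = 2 * of_int n)"
  proof (rule class_minima_injective[OF pos])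
    fix k l k' l'
    assume n: "nearest p q r y z k l" "nearest p q r y' z' k' l'" and e: "even (k - k')" "even (l - l')"
    obtain m n where mn: "chr m n \<in> B" "even (k - m)" "even (l - n)" using complete by blast
    have "even (k' - m)" "even (l' - n)" using e mn by auto
    \<comment> \<open>Undoing the normalisation of \<open>theta_pt\<close> turns \<open>t\<close>
      into another constant that is still independent of the class, as
      \<open>class_minima_injective\<close> demands.\<close>
    from theta_pt[OF n(2) this] theta_pt[OF n(1) mn(2,3)] eq[OF mn(1)]
    show "sform p q r (of_int k - y) (of_int l - z) = sform p q r (of_int k' - y') (of_int l' - z')
        + (4 * t + sform p q r y z - sform p q r y' z')"
      unfolding x x' by (simp add: field_simps)
  qed
  then show ?thesis unfolding x x' pt_simps by (auto simp: pt_mem_L)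
qed

section \<open>Unimodularity of the theta map\<close>

lemma pt_coordinates_bounded:
  obtains N :: int where "\<And>y z. pt y z \<in> ball x 1 \<Longrightarrow> \<bar>y\<bar> \<le> of_int N \<and> \<bar>z\<bar> \<le> of_int N"
proof -
  have "continuous_on (cball x 1) (\<lambda>x. bform Q x x)"
    unfolding bform_def by (intro continuous_intros)
  then have "bounded ((\<lambda>x. bform Q x x) ` cball x 1)"
    by (intro compact_imp_bounded compact_continuous_image) auto
  then obtain K where K: "K > 0" "\<And>x'. x' \<in> cball x 1 \<Longrightarrow> \<bar>bform Q x' x'\<bar> \<le> K"
    unfolding bounded_pos by auto
  \<comment> \<open>From \<open>Q(x, x) \<le> K\<close> come \<open>y^2 \<le> 4 K / p\<close> and
    \<open>z^2 \<le> 4 K / q\<close>; the summand 1 pays for passing from squares to absolute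
    values.\<close>
  define B where "B = 1 + 4 * K / p + 4 * K / q"
  have abs: "\<bar>w\<bar> \<le> 1 + w\<^sup>2" for w :: real
    using zero_le_power2[of "\<bar>w\<bar> - 1"] by (simp add: power2_diff)
  have "\<bar>y\<bar> \<le> of_int \<lceil>B\<rceil> \<and> \<bar>z\<bar> \<le> of_int \<lceil>B\<rceil>" if "pt y z \<in> ball x 1" for y z
  proof -
    have "sform p q r (- y / 2) (- z / 2) \<le> K"
      using K(2)[of "pt y z"] that unfolding pt_def bform_comb_self by auto
    moreover have "sform p q r (- y / 2) (- z / 2) = sform p q r y z / 4"
      unfolding sform_def by (simp add: power2_eq_square field_simps)
    ultimately have "p * y\<^sup>2 + q * z\<^sup>2 + r * (y - z)\<^sup>2 \<le> 4 * K" by (simp add: sform_def)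
    moreover have "0 \<le> p * y\<^sup>2" "0 \<le> q * z\<^sup>2" "0 \<le> r * (y - z)\<^sup>2" using pos by auto
    ultimately have "p * y\<^sup>2 \<le> 4 * K" "q * z\<^sup>2 \<le> 4 * K" by linarith+
    then have "y\<^sup>2 \<le> 4 * K / p" "z\<^sup>2 \<le> 4 * K / q" using pos by (simp_all add: field_simps)
    moreover have "0 \<le> 4 * K / p" "0 \<le> 4 * K / q" using pos K by auto
    ultimately have "\<bar>y\<bar> \<le> B" "\<bar>z\<bar> \<le> B" using abs[of y] abs[of z] unfolding B_def by linarith+
    then show ?thesis using le_of_int_ceiling[of B] by linarith
  qed
  then show ?thesis using that by blast
qed

text \<open>Three of the four nearest points can be taken as the vertices of a unimodular triangle.\<close>

lemma nearest_frame:
  fixes M N :: "nat \<Rightarrow> int"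
  assumes complete: "\<And>k l. \<exists>i<4. even (k - M i) \<and> even (l - N i)"
  obtains \<kappa> \<mu> :: "nat \<Rightarrow> int" and i0 i1 i2 :: nat and s :: int
  where "\<forall>i. nearest p q r y z (\<kappa> i) (\<mu> i) \<and> even (\<kappa> i - M i) \<and> even (\<mu> i - N i) \<and>
      \<bar>of_int (\<kappa> i) - y\<bar> \<le> 2 \<and> \<bar>of_int (\<mu> i) - z\<bar> \<le> 2"
    "i0 < 4" "i1 < 4" "i2 < 4" "s = 1 \<or> s = - 1"
    "\<kappa> i1 - \<kappa> i0 = s" "\<mu> i1 - \<mu> i0 = 0" "\<kappa> i2 - \<kappa> i0 = s" "\<mu> i2 - \<mu> i0 = s"
proof -
  obtain s f e :: int and u v where s: "s = 1 \<or> s = - 1" and t: "0 \<le> v" "v \<le> u" "u \<le> 1"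
    and yz: "y = of_int s * u + of_int f" "z = of_int s * v + of_int e"
    by (rule triangle_cover)
  have n: "nearest p q r y z f e" "nearest p q r y z (s + f) e" "nearest p q r y z (s + f) (s + e)"
    using nearest_affine[OF nearest_00[OF pos t] s, of f e] nearest_affine[OF nearest_10[OF pos t] s, of f e]
      nearest_affine[OF nearest_11[OF pos t] s, of f e] unfolding yz by simp_all
  have "\<forall>i. \<exists>k l. nearest p q r y z k l \<and> even (k - M i) \<and> even (l - N i) \<and>
      \<bar>of_int k - y\<bar> \<le> 2 \<and> \<bar>of_int l - z\<bar> \<le> 2"
    using nearest_exists_bounded[OF pos] by metis
  then obtain k l where kl: "\<And>i. nearest p q r y z (k i) (l i)" "\<And>i. even (k i - M i)" "\<And>i. even (l i - N i)"
      "\<And>i. \<bar>of_int (k i) - y\<bar> \<le> 2" "\<And>i. \<bar>of_int (l i) - z\<bar> \<le> 2"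
    by metis
  obtain i0 where i0: "i0 < 4" "even (f - M i0)" "even (e - N i0)" using complete by blast
  obtain i1 where i1: "i1 < 4" "even (s + f - M i1)" "even (e - N i1)" using complete by blast
  obtain i2 where i2: "i2 < 4" "even (s + f - M i2)" "even (s + e - N i2)" using complete by blast
  \<comment> \<open>The three vertices lie in different classes, so the updates below do not
    overwrite each other.\<close>
  have d: "i0 \<noteq> i1" "i0 \<noteq> i2" "i1 \<noteq> i2" using i0 i1 i2 s by auto
  have bd: "\<bar>of_int f - y\<bar> \<le> 2" "\<bar>of_int (s + f) - y\<bar> \<le> 2" "\<bar>of_int e - z\<bar> \<le> 2" "\<bar>of_int (s + e) - z\<bar> \<le> 2"
    using s t unfolding yz by auto
  show ?thesis
    by (rule that[of "k(i0 := f, i1 := s + f, i2 := s + f)" "l(i0 := e, i1 := e, i2 := s + e)" i0 i1 i2 s])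
      (use d i0 i1 i2 kl n bd s in \<open>auto simp: fun_upd_def\<close>)
qed

text \<open>On a cell of the arrangement, inside the ball, the order of the relevant theta terms is
  constant, so each theta function coincides there with a single term. The linear part is unimodular
  because the characters of a frame differ by a basis of M.\<close>

lemma theta_unimodular:
  fixes M N :: "nat \<Rightarrow> int"
  assumes complete: "\<And>k l. \<exists>i<4. even (k - M i) \<and> even (l - N i)"
  defines "\<theta> \<equiv> \<lambda>i. theta L Q (chr (M i) (N i))"
  shows "unimodular_on UNIV (\<lambda>x. vector [\<theta> 1 x - \<theta> 0 x, \<theta> 2 x - \<theta> 0 x, \<theta> 3 x - \<theta> 0 x] :: real^3)"
    (is "unimodular_on UNIV ?f")
  unfolding unimodular_on_def
proof
  fix x0 :: "real^2"
  obtain K :: int where K: "\<And>y z. pt y z \<in> ball x0 1 \<Longrightarrow> \<bar>y\<bar> \<le> of_int K \<and> \<bar>z\<bar> \<le> of_int K"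
    using pt_coordinates_bounded[of x0] by metis
  \<comment> \<open>Points of the ball have coordinates of size at most \<open>K\<close>, and the
    nearest points used are at most 2 away.\<close>
  define S where "S = {- (K + 2)..K + 2}"
  have in_S: "k \<in> S" "l \<in> S"
    if "pt y z \<in> ball x0 1" "\<bar>of_int k - y\<bar> \<le> 2" "\<bar>of_int l - z\<bar> \<le> 2" for y z k l
  proof -
    have "\<bar>of_int k\<bar> \<le> real_of_int (K + 2)" "\<bar>of_int l\<bar> \<le> real_of_int (K + 2)"
      using K[OF that(1)] that(2,3) by auto
    then show "k \<in> S" "l \<in> S" unfolding S_def by auto
  qed
  \<comment> \<open>These are the loci where \<open>trm k l\<close> and \<open>trm k' l'\<close>
    agree, for all indices in \<open>S\<close>.\<close>
  define J where "J = (\<lambda>(k, l, k', l'). (chr k l - chr k' l',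
      (sform p q r (of_int k') (of_int l') - sform p q r (of_int k) (of_int l)) / 4)) ` (S \<times> S \<times> S \<times> S)"
  have fJ: "finite J" unfolding J_def S_def by simp
  have iJ: "int_vec a" if "(a, c) \<in> J" for a c
    using that chr_int_vec unfolding J_def chr_simps by auto
  have cell: "trm k l x \<le> trm k' l' x"
    if "x \<in> arr_cell J w" "trm k l w \<le> trm k' l' w" "k \<in> S" "l \<in> S" "k' \<in> S" "l' \<in> S" for x w k l k' l'
  proof -
    have "(chr k l - chr k' l', (sform p q r (of_int k') (of_int l') - sform p q r (of_int k) (of_int l)) / 4) \<in> J"
      unfolding J_def using that(3-6) by force
    from arr_cellD(1)[OF that(1) this] that(2) show ?thesis
      unfolding trm_def by (simp add: inner_diff_left diff_divide_distrib)
  qed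
  have loc: "\<exists>A b. unimodular_linear A \<and> (\<forall>x \<in> \<sigma> \<inter> ball x0 1 \<inter> UNIV. ?f x = A *v x + b)"
    if \<sigma>: "\<sigma> \<in> range (arr_cell J)" and x1: "x1 \<in> \<sigma> \<inter> ball x0 1" for \<sigma> x1
  proof -
    obtain w0 where w0: "\<sigma> = arr_cell J w0" using \<sigma> by blast
    \<comment> \<open>The cell is indexed anew by a point \<open>w\<close> of the ball, so that the
      nearest points chosen for \<open>w\<close> have coordinates in \<open>S\<close>.\<close>
    have "x1 \<in> ball x0 1" "x1 \<in> arr_cell J w0" using x1 unfolding w0 by simp_all
    then obtain w where w: "w \<in> ball x0 1" "arr_cell J w = \<sigma>"
      using arr_cell_meets_open[OF open_ball] unfolding w0 by metis
    obtain y z where yz: "w = pt y z" by (rule pt_cases)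
    obtain \<kappa> \<mu> :: "nat \<Rightarrow> int" and i0 i1 i2 :: nat and s :: int
      where "\<forall>i. nearest p q r y z (\<kappa> i) (\<mu> i) \<and> even (\<kappa> i - M i) \<and> even (\<mu> i - N i) \<and>
          \<bar>of_int (\<kappa> i) - y\<bar> \<le> 2 \<and> \<bar>of_int (\<mu> i) - z\<bar> \<le> 2"
        and i: "i0 < 4" "i1 < 4" "i2 < 4" and s: "s = 1 \<or> s = - 1"
        and d: "\<kappa> i1 - \<kappa> i0 = s" "\<mu> i1 - \<mu> i0 = 0" "\<kappa> i2 - \<kappa> i0 = s" "\<mu> i2 - \<mu> i0 = s"
      by (rule nearest_frame[OF complete])
    then have n: "\<And>i. nearest p q r y z (\<kappa> i) (\<mu> i)" "\<And>i. even (\<kappa> i - M i)" "\<And>i. even (\<mu> i - N i)"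
      and bd: "\<And>i. \<bar>of_int (\<kappa> i) - y\<bar> \<le> 2" "\<And>i. \<bar>of_int (\<mu> i) - z\<bar> \<le> 2"
      by auto
    define c where "c i = chr (\<kappa> i) (\<mu> i)" for i
    define e where "e i = sform p q r (of_int (\<kappa> i)) (of_int (\<mu> i)) / 4" for i
    define A :: "real^2^3" where "A = vector [c 1 - c 0, c 2 - c 0, c 3 - c 0]"
    have \<theta>: "\<theta> i x = c i \<bullet> x + e i" if x: "x \<in> \<sigma>" "x \<in> ball x0 1" for i x
    proof -
      obtain y' z' where x': "x = pt y' z'" by (rule pt_cases)
      obtain k l where kl: "nearest p q r y' z' k l" "even (k - \<kappa> i)" "even (l - \<mu> i)"
          "\<bar>of_int k - y'\<bar> \<le> 2" "\<bar>of_int l - z'\<bar> \<le> 2"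
        by (rule nearest_exists_bounded[OF pos])
      have S: "k \<in> S" "l \<in> S" "\<kappa> i \<in> S" "\<mu> i \<in> S"
        using in_S[of y' z' k l] in_S[of y z "\<kappa> i" "\<mu> i"] kl bd x w x' yz by auto
      \<comment> \<open>The term chosen at \<open>w\<close> is minimal in its class there, and this
        comparison persists on the cell. As the term of \<open>k, l\<close> is minimal at
        \<open>x\<close>, the two agree at \<open>x\<close>.\<close>
      have "trm (\<kappa> i) (\<mu> i) w \<le> trm k l w"
        unfolding yz trm_le_iff using n(1)[of i] kl(2,3) unfolding nearest_def by blast
      then have "trm (\<kappa> i) (\<mu> i) x \<le> trm k l x" using cell[of x w] x(1) w(2) S by blast
      moreover have "trm k l x \<le> trm (\<kappa> i) (\<mu> i) x"
        unfolding x' trm_le_iff using kl(1-3) unfolding nearest_def by (metis dvd_diff_commute)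
      moreover have "even (k - M i)" "even (l - N i)" using kl(2,3) n(2,3)[of i] by auto
      ultimately have "\<theta> i x = trm (\<kappa> i) (\<mu> i) x"
        unfolding \<theta>_def x' using theta_attained(4)[OF kl(1)] by auto
      then show ?thesis unfolding trm_def c_def e_def .
    qed
    have A1: "(A *v x) $ 1 = (c 1 - c 0) \<bullet> x" "(A *v x) $ 2 = (c 2 - c 0) \<bullet> x" "(A *v x) $ 3 = (c 3 - c 0) \<bullet> x" for x
      by (simp_all add: A_def matrix_vector_mul_component)
    have "unimodular_linear A"
    proof (rule unimodular_linearI)
      fix v :: "real^2"
      show "int_vec (A *v v) \<longleftrightarrow> int_vec v"
      proof
        assume "int_vec (A *v v)"
        then have "(c 1 - c 0) \<bullet> v \<in> \<int>" "(c 2 - c 0) \<bullet> v \<in> \<int>" "(c 3 - c 0) \<bullet> v \<in> \<int>"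
          by (auto simp: int_vec_def forall_3 A1)
        then have c0: "(c j - c 0) \<bullet> v \<in> \<int>" if "j < 4" for j
          using that by (auto simp: eval_nat_numeral less_Suc_eq)
        \<comment> \<open>The frame need not contain the index 0, so the differences of all pairs
          are formed. Those of the frame give \<open>s\<close> times the images of \<open>g\<close>
          and \<open>g + h\<close>, a basis of M.\<close>
        have "(c j - c j') \<bullet> v \<in> \<int>" if "j < 4" "j' < 4" for j j'
          using Ints_diff[OF c0[OF that(1)] c0[OF that(2)]] by (simp add: inner_diff_left)
        then have "chr s 0 \<bullet> v \<in> \<int>" "chr s s \<bullet> v \<in> \<int>"
          using i d unfolding c_def chr_simps by metis+
        then have 1: "of_int s * (pol_lambda Q g \<bullet> v) \<in> \<int>"
          "of_int s * (pol_lambda Q g \<bullet> v) + of_int s * (pol_lambda Q h \<bullet> v) \<in> \<int>"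
          by (auto simp: chr_eq inner_add_left)
        then have "of_int s * (pol_lambda Q h \<bullet> v) \<in> \<int>" using Ints_diff[OF 1(2) 1(1)] by simp
        then have "pol_lambda Q g \<bullet> v \<in> \<int>" "pol_lambda Q h \<bullet> v \<in> \<int>"
          using 1(1) s by (auto simp: minus_in_Ints_iff)
        then show "int_vec v" unfolding int_vec_dual_basis[OF pr zb] by blast
      next
        assume "int_vec v"
        then have "pol_lambda Q g \<bullet> v \<in> \<int>" "pol_lambda Q h \<bullet> v \<in> \<int>"
          unfolding int_vec_dual_basis[OF pr zb] by auto
        then have "chr k l \<bullet> v \<in> \<int>" for k l
          unfolding chr_eq inner_add_left inner_scaleR_left by (intro Ints_add Ints_mult) auto
        then show "int_vec (A *v v)" unfolding int_vec_def forall_3 A1 c_def chr_simps by blast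
      qed
    qed
    moreover have "?f x = A *v x + vector [e 1 - e 0, e 2 - e 0, e 3 - e 0]" if "x \<in> \<sigma> \<inter> ball x0 1 \<inter> UNIV" for x
      using that \<theta>[of x] by (simp add: vec_eq_iff forall_3 A1 inner_diff_left)
    ultimately show ?thesis by blast
  qed
  have un: "\<Union> (range (arr_cell J)) = UNIV" using arr_cell_self by blast
  show "\<exists>U' C. open U' \<and> x0 \<in> U' \<and> U' \<subseteq> UNIV \<and> polyhedral_complex C \<and> openin (top_of_set (\<Union> C)) U' \<and>
      (\<forall>\<sigma>\<in>C. \<forall>q\<in>\<sigma> \<inter> U'. \<exists>V. open V \<and> q \<in> V \<and>
         (\<exists>A b. unimodular_linear A \<and> (\<forall>x\<in>\<sigma> \<inter> U' \<inter> V. ?f x = A *v x + b)))"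
  proof (rule exI[of _ "ball x0 1"], rule exI[of _ "range (arr_cell J)"], intro conjI ballI)
    show "open (ball x0 1)" "x0 \<in> ball x0 1" "ball x0 1 \<subseteq> UNIV" by auto
    show "polyhedral_complex (range (arr_cell J))" by (rule polyhedral_complex_arrangement[OF fJ iJ])
    show "openin (top_of_set (\<Union> (range (arr_cell J)))) (ball x0 1)" unfolding un by simp
  next
    fix \<sigma> q assume a: "\<sigma> \<in> range (arr_cell J)" "q \<in> \<sigma> \<inter> ball x0 1"
    show "\<exists>V. open V \<and> q \<in> V \<and> (\<exists>A b. unimodular_linear A \<and> (\<forall>x\<in>\<sigma> \<inter> ball x0 1 \<inter> V. ?f x = A *v x + b))"
      using loc[OF a] by (intro exI[of _ UNIV]) simp
  qed
qed

end

section \<open>Irreducible surfaces and the final assembly\<close>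

lemma selling_basis_exists:
  assumes "full_lattice L" "polarization L Q" "principal L Q" "\<not> product_type L Q"
  obtains g h p q r where "selling_basis L Q g h p q r"
proof -
  have sym: "transpose Q = Q" and pd: "\<And>x. x \<noteq> 0 \<Longrightarrow> bform Q x x > 0"
    using assms(2) unfolding polarization_def by auto
  obtain g0 h0 where "zbasis L g0 h0" by (rule full_lattice_zbasis[OF assms(1)])
  then obtain g h where zb: "zbasis L g h" and ob: "bform Q g h \<le> 0" "bform Q g (g + h) \<ge> 0" "bform Q h (g + h) \<ge> 0"
    using obtuse_superbase_exists[OF sym pd] by metis
  have zb1: "zbasis L (- (g + h)) g" by (rule zbasis_rotate[OF zb])
  have zb2: "zbasis L h (- (g + h))" using zbasis_rotate[OF zb1] by simp
  have neg: "bform Q (- x) y = - bform Q x y" "bform Q x (- y) = - bform Q x y" for x y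
    using bform_bilinear(3)[of Q "-1" x y] bform_bilinear(4)[of Q x "-1" y] by auto
  have no: "bform Q g' h' \<noteq> 0" if "zbasis L g' h'" for g' h'
    using product_type_if_orthogonal[OF sym pd assms(3) that] assms(4) by blast
  \<comment> \<open>Each of the three pairs of the superbase is a basis of the lattice, and an
    orthogonal one would split the surface. Hence the weak signs of Selling reduction become
    strict.\<close>
  have "bform Q g h \<noteq> 0" "bform Q g (g + h) \<noteq> 0" "bform Q h (g + h) \<noteq> 0"
    using no[OF zb] no[OF zb1] no[OF zb2] unfolding neg bform_sym[OF sym, of "g + h" g] by auto
  then have "selling_basis L Q g h (bform Q g (g + h)) (bform Q h (g + h)) (- bform Q g h)"
    using ob bform_sym[OF sym, of h g] by unfold_locales (auto simp: sym pd assms(3) zb bform_bilinear)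
  then show ?thesis by (rule that)
qed

theorem theorem4p3:
  fixes L :: "(real^2) set" and Q :: "real^2^2" and b :: "nat \<Rightarrow> real^2"
  assumes "full_lattice L" and "polarization L Q" and "principal L Q"
    and "\<not> product_type L Q"
    and "\<forall>i<4. b i \<in> Zpts"
    and "\<forall>m\<in>Zpts. \<exists>!i. i < 4 \<and> m - b i \<in> (\<lambda>u. 2 *\<^sub>R pol_lambda Q u) ` L"
  shows "(\<forall>i<4. \<forall>x. \<exists>u\<in>L. theta L Q (b i) x = theta_term Q (b i) x u \<and>
                         (\<forall>v\<in>L. theta_term Q (b i) x u \<le> theta_term Q (b i) x v))
       \<and> (\<forall>x. \<forall>u\<in>L. \<exists>t. \<forall>i<4. theta L Q (b i) (x + u) = theta L Q (b i) x + t)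
       \<and> (\<forall>x. \<exists>t. \<forall>i<4. theta L Q (b i) (- x) = theta L Q (b i) x + t)
       \<and> (\<forall>x y. (\<exists>t. \<forall>i<4. theta L Q (b i) x = theta L Q (b i) y + t)
                 \<longrightarrow> (x - y \<in> L \<or> x + y \<in> L))
       \<and> unimodular_on UNIV (\<lambda>x. vector [theta L Q (b 1) x - theta L Q (b 0) x,
                                          theta L Q (b 2) x - theta L Q (b 0) x,
                                          theta L Q (b 3) x - theta L Q (b 0) x] :: real^3)"
proof -
  obtain g h p q r where "selling_basis L Q g h p q r"
    by (rule selling_basis_exists[OF assms(1-4)])
  then interpret selling_basis L Q g h p q r .
  have "\<exists>m n. i < 4 \<longrightarrow> b i = chr m n" for i using assms(5) chr_cases by metis
  then obtain M N where MN: "\<And>i. i < 4 \<Longrightarrow> b i = chr (M i) (N i)" by metis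
  \<comment> \<open>Since \<open>pol_lambda Q\<close> maps \<open>L\<close> onto M, the classes
    modulo twice this image are the parity classes of the coordinates \<open>(k, l)\<close>.\<close>
  have complete: "\<exists>i<4. even (k - M i) \<and> even (l - N i)" for k l
  proof -
    have "chr k l \<in> Zpts" using chr_int_vec unfolding Zpts_def by blast
    then obtain i u where i: "i < 4" "u \<in> L" "chr k l - b i = 2 *\<^sub>R pol_lambda Q u" using assms(6) by blast
    obtain a c :: int where u: "u = comb (of_int a) (of_int c)" by (rule comb_cases[OF i(2)])
    have "pol_lambda Q (comb (of_int (k - M i)) (of_int (l - N i))) = pol_lambda Q (comb (2 * of_int a) (2 * of_int c))"
      using i(3) unfolding MN[OF i(1)] chr_simps u pol_lambda_linear(2)[symmetric] comb_simps
      unfolding chr_def .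
    then have "comb (of_int (k - M i)) (of_int (l - N i)) = comb (of_int (2 * a)) (of_int (2 * c))"
      using pol_lambda_inj by (simp add: inj_eq)
    then have "k - M i = 2 * a" "l - N i = 2 * c" unfolding comb_inject of_int_eq_iff by auto
    then have "even (k - M i)" "even (l - N i)" by (metis dvd_triv_left)+
    then show ?thesis using i(1) by blast
  qed
  have "x - y \<in> L \<or> x + y \<in> L" if "\<forall>i<4. theta L Q (b i) x = theta L Q (b i) y + t" for x y t
  proof (rule theta_injective[of "b ` {..<4}"])
    show "b ` {..<4} \<subseteq> Zpts" using assms(5) by auto
    show "\<exists>m n. chr m n \<in> b ` {..<4} \<and> even (k - m) \<and> even (l - n)" for k l
    proof -
      obtain i where i: "i < 4" "even (k - M i)" "even (l - N i)" using complete by blast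
      have "chr (M i) (N i) \<in> b ` {..<4}" unfolding MN[OF i(1), symmetric] using i(1) by blast
      then show ?thesis using i by blast
    qed
  qed (use that in auto)
  moreover have "\<exists>t. \<forall>i<4. theta L Q (b i) (x + u) = theta L Q (b i) x + t" if "u \<in> L" for x u
    using theta_translate[OF that, of x] assms(5) by blast
  moreover have "\<exists>t. \<forall>i<4. theta L Q (b i) (- x) = theta L Q (b i) x + t" for x
    using theta_uminus assms(5) by (intro exI[of _ 0]) simp
  moreover have "unimodular_on UNIV (\<lambda>x. vector [theta L Q (b 1) x - theta L Q (b 0) x,
      theta L Q (b 2) x - theta L Q (b 0) x, theta L Q (b 3) x - theta L Q (b 0) x] :: real^3)"
    using theta_unimodular[of M N] complete MN[of 0] MN[of 1] MN[of 2] MN[of 3] by simp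
  ultimately show ?thesis using theta_min_exists assms(5) by blast
qed

end
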